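(* The abstract initial-boundary value problem $$\left\{\begin{array}{ll}\dot{\mathbf u}(t)=\mathbb{A}\mathbf u(t), & t\in\mathbb{R},\\ \dot{\mathbf x}(t)=\mathbb{B}\mathbf u(t)+\tilde{\mathbb{B}}\mathbf x(t), & t\in\mathbb{R},\\ \mathbf x(t)=\mathcal{R}\mathbf u(t), & t\in\mathbb{R},\\ \mathbf u(0)=\mathbf u_0,\quad \mathbf x(0)=\mathbf x_0,\end{array}\right.$$ on $\mathbb{X}=Y\times X\times\partial X$ and $\partial\mathbb{X}=\partial X$ is well-posed.
   Context: Standing assumptions: $X$, $Y$, $\partial X$ are Banach spaces ($\partial X$ is just the name of a third Banach space) with $Y\hookrightarrow X$ (continuous embedding). $A:D(A)\to X$ is linear with $D(A)\subset Y$; $R:D(A)\to\partial X$ is linear and surjective; $B_1,B_2\in\mathcal{L}(Y,\partial X)$; $B_3,B_4\in\mathcal{L}(\partial X)$; the operator $\binom{A}{R}:D(A)\subset Y\to X\times\partial X$, $u\mapsto(Au,Ru)$, is closed; the restriction $A_0:=A|_{\ker R}$ generates a cosine operator function with associated phase space $Y\times X$ (i.e. the operator matrix $\begin{pmatrix} 0 & I_Y \\ A_0 & 0 \end{pmatrix}$ with domain $D(A_0)\times Y$ generates a strongly continuous group on $Y\times X$). Put $L:=R+B_2:D(A)\to\partial X$. Operators: $$\mathbb{A}=\begin{pmatrix} 0 & I_Y & 0 \\ A & 0 & 0 \\ L & 0 & 0 \end{pmatrix},\quad D(\mathbb{A})=D(A)\times Y\times\partial X,$$ $\mathcal{R}=(R\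 \ 0\ \ 0)$ with $D(\mathcal{R})=D(\mathbb{A})$, $\mathbb{B}=(B_1+B_4B_2\ \ 0\ \ B_3)$ on $\mathbb{X}$, both with values in $\partial\mathbb{X}$, and $\tilde{\mathbb{B}}=B_4$ on $\partial\mathbb{X}$. A classical solution is a function $\mathbf u\in C^1(\mathbb{R},\mathbb{X})$ with $\mathbf u(t)\in D(\mathbb{A})$ for all $t$ and $\mathbf x=\mathcal{R}\mathbf u\in C^1(\mathbb{R},\partial\mathbb{X})$ satisfying the problem pointwise. Well-posedness means: for every $\mathbf u_0\in D(\mathbb{A})$ and $\mathbf x_0=\mathcal{R}\mathbf u_0$ there is a unique classical solution; the set $\{(\mathbf u_0,\mathcal{R}\mathbf u_0):\mathbf u_0\in D(\mathbb{A})\}$ is dense in $\mathbb{X}\times\partial\mathbb{X}$; and $(\mathbf u,\mathbf x)$ depends continuously on $(\mathbf u_0,\mathbf x_0)$ in the norm of $\mathbb{X}\times\partial\mathbb{X}$, uniformly on compact time intervals. *)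

theory Defs
  imports "HOL-Analysis.Analysis"
begin

text \<open>
  An unbounded operator is given by its domain \<open>D\<close> together with a total function
  whose values outside \<open>D\<close> are irrelevant.  Real scalars are used throughout; a complex
  Banach space is in particular a real one, and complex-linear maps are real-linear.
\<close>

definition linear_operator_on ::
  "'a::real_vector set \<Rightarrow> ('a \<Rightarrow> 'b::real_vector) \<Rightarrow> bool" where
  "linear_operator_on D T \<longleftrightarrow>
     subspace D \<and>
     (\<forall>u\<in>D. \<forall>v\<in>D. T (u + v) = T u + T v) \<and>
     (\<forall>c. \<forall>u\<in>D. T (c *\<^sub>R u) = c *\<^sub>R T u)"

definition closed_operator ::
  "'a::real_normed_vector set \<Rightarrow> ('a \<Rightarrow> 'b::real_normed_vector) \<Rightarrow> bool" where
  "closed_operator D T \<longleftrightarrow> closed ((\<lambda>u. (u, T u)) ` D)"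

definition strongly_continuous_group :: "(real \<Rightarrow> 'a::banach \<Rightarrow> 'a) \<Rightarrow> bool" where
  "strongly_continuous_group T \<longleftrightarrow>
     (\<forall>t. bounded_linear (T t)) \<and>
     T 0 = id \<and>
     (\<forall>s t. T (s + t) = T s \<circ> T t) \<and>
     (\<forall>x. continuous_on UNIV (\<lambda>t. T t x))"

text \<open>The equivalence also fixes the domain: \<open>D\<close> is exactly the set of \<open>x\<close> whose orbit is
  differentiable at \<open>0\<close>.\<close>

definition generates_group :: "'a::banach set \<Rightarrow> ('a \<Rightarrow> 'a) \<Rightarrow> bool" where
  "generates_group D G \<longleftrightarrow>
     (\<exists>T. strongly_continuous_group T \<and>
        (\<forall>x y. ((\<lambda>t. T t x) has_vector_derivative y) (at 0) \<longleftrightarrow> x \<in> D \<and> y = G x))"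

text \<open>
  The embedding of \<open>Y\<close> into \<open>X\<close> is an injective bounded linear map \<open>j\<close>, so that the
  subset \<open>Y\<close> of \<open>X\<close> is \<open>range j\<close>, and the entry \<open>I\<^sub>Y\<close> of an operator matrix,
  acting on the \<open>X\<close>-component, is \<open>inv j\<close>.
\<close>

definition continuous_embedding :: "('y::real_normed_vector \<Rightarrow> 'x::real_normed_vector) \<Rightarrow> bool" where
  "continuous_embedding j \<longleftrightarrow> bounded_linear j \<and> inj j"

text \<open>\<open>A\<^sub>0\<close> with domain \<open>D0 \<subseteq> Y\<close> generates a cosine operator function with associated
  phase space \<open>Y \<times> X\<close>.\<close>

definition generates_cosine_with_phase_space ::
  "('y::banach \<Rightarrow> 'x::banach) \<Rightarrow> 'y set \<Rightarrow> ('y \<Rightarrow> 'x) \<Rightarrow> bool" where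
  "generates_cosine_with_phase_space j D0 A0 \<longleftrightarrow>
     generates_group (D0 \<times> range j) (\<lambda>(u, v). (inv j v, A0 u))"

definition bigA_dom ::
  "('y \<Rightarrow> 'x) \<Rightarrow> 'y set \<Rightarrow> ('y \<times> 'x \<times> 'b) set" where
  "bigA_dom j DA = DA \<times> range j \<times> UNIV"

definition bigA ::
  "('y \<Rightarrow> 'x) \<Rightarrow> ('y \<Rightarrow> 'x) \<Rightarrow> ('y \<Rightarrow> 'b) \<Rightarrow> 'y \<times> 'x \<times> 'b \<Rightarrow> 'y \<times> 'x \<times> 'b" where
  "bigA j A L = (\<lambda>(u, v, d). (inv j v, A u, L u))"

definition bigR :: "('y \<Rightarrow> 'b) \<Rightarrow> 'y \<times> 'x \<times> 'b \<Rightarrow> 'b" where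
  "bigR R = (\<lambda>(u, v, d). R u)"

definition bigB ::
  "('y \<Rightarrow> 'b) \<Rightarrow> ('y \<Rightarrow> 'b) \<Rightarrow> ('b \<Rightarrow> 'b) \<Rightarrow> ('b \<Rightarrow> 'b) \<Rightarrow> 'y \<times> 'x \<times> 'b \<Rightarrow> 'b::plus" where
  "bigB B1 B2 B3 B4 = (\<lambda>(u, v, d). (B1 u + B4 (B2 u)) + B3 d)"

text \<open>
  The abstract initial-boundary value problem
  \<open>u' = G u\<close>, \<open>x' = B u + Bt x\<close>, \<open>x = R u\<close>, \<open>u 0 = u0\<close>, \<open>x 0 = x0\<close>
  for an operator \<open>G\<close> with domain \<open>D\<close>.
\<close>

definition classical_solution ::
  "'e::banach set \<Rightarrow> ('e \<Rightarrow> 'e) \<Rightarrow> ('e \<Rightarrow> 'f::banach) \<Rightarrow> ('e \<Rightarrow> 'f) \<Rightarrow> ('f \<Rightarrow> 'f)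
     \<Rightarrow> 'e \<Rightarrow> 'f \<Rightarrow> (real \<Rightarrow> 'e) \<Rightarrow> bool" where
  "classical_solution D G R B Bt u0 x0 u \<longleftrightarrow>
     (let x = (\<lambda>t. R (u t)) in
        u C1_differentiable_on UNIV \<and>
        x C1_differentiable_on UNIV \<and>
        (\<forall>t. u t \<in> D) \<and>
        (\<forall>t. (u has_vector_derivative G (u t)) (at t)) \<and>
        (\<forall>t. (x has_vector_derivative B (u t) + Bt (x t)) (at t)) \<and>
        u 0 = u0 \<and> x 0 = x0)"

definition well_posed ::
  "'e::banach set \<Rightarrow> ('e \<Rightarrow> 'e) \<Rightarrow> ('e \<Rightarrow> 'f::banach) \<Rightarrow> ('e \<Rightarrow> 'f) \<Rightarrow> ('f \<Rightarrow> 'f) \<Rightarrow> bool" where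
  "well_posed D G R B Bt \<longleftrightarrow>
     (\<forall>u0\<in>D. \<exists>!u. classical_solution D G R B Bt u0 (R u0) u) \<and>
     closure {(u0, R u0) | u0. u0 \<in> D} = UNIV \<and>
     (\<forall>u0\<in>D. \<forall>u. classical_solution D G R B Bt u0 (R u0) u \<longrightarrow>
        (\<forall>a b. \<forall>\<epsilon>>0. \<exists>\<delta>>0. \<forall>v0\<in>D. \<forall>v. classical_solution D G R B Bt v0 (R v0) v \<longrightarrow>
           dist (v0, R v0) (u0, R u0) < \<delta> \<longrightarrow>
           (\<forall>t\<in>{a..b}. dist (v t, R (v t)) (u t, R (u t)) < \<epsilon>)))"

end

theory Submission
  imports Defs
begin

text \<open>
  Adjoin the boundary value \<open>x = R u\<close> to the state \<open>(u, v, d)\<close>.  The problem then becomes a Cauchy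
  problem \<open>z' = \<A> z\<close> for \<open>z = ((u, v, d), x)\<close>, with
  \<open>\<A> ((u, v, d), x) = ((v, A u, L u), (B\<^sub>1 + B\<^sub>4 B\<^sub>2) u + B\<^sub>3 d + B\<^sub>4 x)\<close>; the boundary condition \<open>x = R u\<close>
  has moved into the domain of \<open>\<A>\<close>.  If \<open>\<A>\<close> generates a strongly continuous group, then the orbits
  that start in the domain are exactly the classical solutions, and the domain of a generator is
  dense, so the problem is well-posed (\<open>well_posed_if_generates_group\<close>).

  The coupling in the domain is removed by a similarity transformation.  The generator of a group
  has a real \<open>l\<close> in its resolvent set (\<open>generator_has_resolvent\<close>), and this together with the
  surjectivity of \<open>R\<close> makes the problem \<open>A e = l\<^sup>2 e\<close>, \<open>R e = x\<close> uniquely solvable.  The solution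
  operator \<open>E\<close> is bounded from the boundary space to \<open>Y\<close> because the operator \<open>(A, R)\<close> is closed
  (\<open>dirichlet_operator_exists\<close>).  In the variable \<open>w = u - E x\<close> the condition \<open>R u = x\<close> reads
  \<open>R w = 0\<close>, and the equations become
  \<open>w' = v - E x'\<close>, \<open>v' = A\<^sub>0 w + l\<^sup>2 E x\<close>, \<open>d' = x + B\<^sub>2 (w + E x)\<close>,
  \<open>x' = (B\<^sub>1 + B\<^sub>4 B\<^sub>2) (w + E x) + B\<^sub>3 d + B\<^sub>4 x\<close>.
  Substituting the last equation into the first, one sees the generator of the phase space group,
  extended by \<open>0\<close> in the variables \<open>d\<close> and \<open>x\<close>, plus a bounded operator.  Bounded perturbations of
  generators of groups generate groups (\<open>bounded_perturbation_generates_group\<close>).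

  The functional analysis behind these steps rests on the Baire category theorem through a single
  statement, Zabreiko's lemma (\<open>countably_subadditive_seminorm_bounded\<close>), which yields the
  uniform boundedness principle, needed for local bounds on a group, and the closed graph
  theorem, needed for \<open>E\<close>.
\<close>

section \<open>Zabreiko's lemma and its corollaries\<close>

text \<open>
  By Baire, the closure of some sublevel set of \<open>p\<close> contains a ball, and by symmetry and convexity
  a ball of radius \<open>r\<close> about \<open>0\<close>.  So every small vector is approximated, with half the previous error, by
  vectors of controlled seminorm; iterating writes it as a series whose terms have geometrically
  decaying seminorms, and countable subadditivity bounds its own seminorm.
\<close>

lemma countably_subadditive_seminorm_bounded:
  fixes p :: "'a::banach \<Rightarrow> real"
  assumes nonneg: "\<And>x. 0 \<le> p x"
    and scale: "\<And>c x. p (c *\<^sub>R x) = \<bar>c\<bar> * p x"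
    and csub: "\<And>x s. summable (\<lambda>n. p (x n)) \<Longrightarrow> x sums s \<Longrightarrow> p s \<le> (\<Sum>n. p (x n))"
  shows "\<exists>M. \<forall>x. p x \<le> M * norm x"
proof -
  have p0: "p 0 = 0" using scale[of 0 0] by simp
  have p_add: "p (a + b) \<le> p a + p b" for a b
  proof -
    let ?x = "\<lambda>n::nat. if n = 0 then a else if n = 1 then b else 0"
    have "?x sums (\<Sum>n\<in>{0,1}. ?x n)"
      by (rule sums_finite) auto
    moreover have "(\<lambda>n. p (?x n)) sums (\<Sum>n\<in>{0,1}. p (?x n))"
      by (rule sums_finite) (auto simp: p0)
    ultimately show ?thesis
      using csub[of ?x "a + b"] by (auto simp: sums_iff)
  qed
  have p_diff: "p (a - b) \<le> p a + p b" for a b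
    using p_add[of a "- b"] scale[of "-1" b] by simp
  define A where "A n = closure {x. p x \<le> real n}" for n :: nat
  have cover: "\<Union>(range A) = UNIV"
  proof -
    have "x \<in> A (nat \<lceil>p x\<rceil>)" for x
      unfolding A_def by (rule subsetD[OF closure_subset]) (use nonneg[of x] in \<open>simp add: of_nat_ceiling\<close>)
    then show ?thesis by blast
  qed
  have "\<exists>n. interior (A n) \<noteq> {}"
  proof (rule ccontr)
    assume no: "\<not> ?thesis"
    have "euclidean interior_of \<Union>(range A) = {}"
      by (rule Baire_category_alt)
        (use no in \<open>auto simp: A_def completely_metrizable_space_euclidean\<close>)
    then show False unfolding cover by simp
  qed
  then obtain n c where "c \<in> interior (A n)" by blast
  then obtain r where r: "r > 0" "ball c r \<subseteq> A n"
    by (meson interior_subset mem_interior)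
  \<comment> \<open>The centre of the ball is moved to \<open>0\<close> by averaging approximations of \<open>c + y\<close> and \<open>-(c - y)\<close>.\<close>
  have approx: "\<exists>a. p a \<le> real n \<and> norm (y - a) < e" if "norm y < r" "e > 0" for y e
  proof -
    have "c + y \<in> A n" "c - y \<in> A n"
      using r(2) that by (auto simp: dist_norm subset_iff)
    then obtain a b where a: "p a \<le> real n" "dist a (c + y) < e"
        and b: "p b \<le> real n" "dist b (c - y) < e"
      unfolding A_def closure_approachable using \<open>e > 0\<close> by blast
    have "p ((1/2) *\<^sub>R (a - b)) \<le> real n"
      unfolding scale using p_diff[of a b] a(1) b(1) by simp
    moreover have "norm (y - (1/2) *\<^sub>R (a - b)) < e"
    proof -
      have "y - (1/2) *\<^sub>R (a - b) = (1/2) *\<^sub>R ((c + y - a) - (c - y - b))"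
        by (simp add: algebra_simps flip: scaleR_add_left)
      then have "norm (y - (1/2) *\<^sub>R (a - b)) = (1/2) * norm ((c + y - a) - (c - y - b))"
        by simp
      also have "\<dots> \<le> (1/2) * (norm (c + y - a) + norm (c - y - b))"
        by (rule mult_left_mono[OF norm_triangle_ineq4]) simp
      also have "\<dots> < e" using a(2) b(2) by (simp add: dist_norm norm_minus_commute)
      finally show ?thesis .
    qed
    ultimately show ?thesis by blast
  qed
  have approx': "\<exists>a. p a \<le> real n * (1/2)^k \<and> norm (y - a) < r * (1/2)^Suc k"
    if "norm y < r * (1/2)^k" for y k
  proof -
    have "norm (2^k *\<^sub>R y) < r" using that by (simp add: power_divide field_simps)
    from approx[OF this, of "r/2"] r(1) obtain a where a: "p a \<le> real n" "norm (2^k *\<^sub>R y - a) < r/2"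
      by auto
    have "y - (1/2)^k *\<^sub>R a = (1/2)^k *\<^sub>R (2^k *\<^sub>R y - a)"
      by (simp add: scaleR_diff_right power_divide)
    then have "norm (y - (1/2)^k *\<^sub>R a) = (1/2)^k * norm (2^k *\<^sub>R y - a)" by (simp add: power_divide)
    also have "\<dots> < (1/2)^k * (r/2)" using a(2) by (intro mult_strict_left_mono) auto
    finally have "norm (y - (1/2)^k *\<^sub>R a) < r * (1/2)^Suc k" by (simp add: field_simps)
    moreover have "p ((1/2)^k *\<^sub>R a) \<le> real n * (1/2)^k"
      unfolding scale using a(1) by (simp add: mult.commute mult_left_mono)
    ultimately show ?thesis by blast
  qed
  have bound: "p y \<le> 2 * real n" if y: "norm y < r" for y
  proof -
    \<comment> \<open>\<open>z k\<close> is the remainder after \<open>k\<close> approximation steps.\<close>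
    obtain z where z: "z 0 = y" "\<And>k. norm (z k) < r * (1/2)^k"
        "\<And>k. p (z k - z (Suc k)) \<le> real n * (1/2)^k"
    proof -
      have "\<exists>f. \<forall>k. (norm (f k) < r * (1/2)^k \<and> (k = 0 \<longrightarrow> f k = y)) \<and> p (f k - f (Suc k)) \<le> real n * (1/2)^k"
      proof (rule dependent_nat_choice)
        show "\<exists>x. norm x < r * (1/2)^0 \<and> (0 = 0 \<longrightarrow> x = y)" using y by simp
      next
        fix x k assume "norm x < r * (1/2)^k \<and> (k = 0 \<longrightarrow> x = y)"
        then obtain a where "p a \<le> real n * (1/2)^k" "norm (x - a) < r * (1/2)^Suc k"
          using approx' by blast
        then show "\<exists>w. (norm w < r * (1/2)^Suc k \<and> (Suc k = 0 \<longrightarrow> w = y)) \<and> p (x - w) \<le> real n * (1/2)^k"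
          by (intro exI[of _ "x - a"]) auto
      qed
      then show ?thesis using that by blast
    qed
    have "z \<longlonglongrightarrow> 0"
    proof (rule Lim_null_comparison)
      show "\<forall>\<^sub>F k in sequentially. norm (z k) \<le> r * (1/2)^k" using z(2) by (simp add: less_imp_le)
      show "(\<lambda>k. r * (1/2::real)^k) \<longlonglongrightarrow> 0"
        by (intro tendsto_mult_right_zero LIMSEQ_power_zero) auto
    qed
    from telescope_sums'[OF this] have sums: "(\<lambda>k. z k - z (Suc k)) sums y" by (simp add: z(1))
    have geo: "(\<lambda>k. real n * (1/2::real)^k) sums (real n * 2)"
      using geometric_sums[of "1/2::real"] by (intro sums_mult) auto
    have summ: "summable (\<lambda>k. p (z k - z (Suc k)))"
      by (rule summable_comparison_test'[OF sums_summable[OF geo]]) (use z(3) nonneg in auto)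
    have "p y \<le> (\<Sum>k. p (z k - z (Suc k)))" by (rule csub[OF summ sums])
    also have "\<dots> \<le> (\<Sum>k. real n * (1/2::real)^k)"
      by (rule suminf_le[OF z(3) summ sums_summable[OF geo]])
    finally show ?thesis using sums_unique[OF geo] by simp
  qed
  have "p x \<le> (4 * real n / r) * norm x" for x
  proof (cases "x = 0")
    case False
    have "p ((r / (2 * norm x)) *\<^sub>R x) \<le> 2 * real n" by (rule bound) (use False r(1) in simp)
    then show ?thesis unfolding scale using False r(1) by (simp add: field_simps)
  qed (simp add: p0)
  then show ?thesis by blast
qed

text \<open>The supremum \<open>p x = sup\<^sub>i \<parallel>T\<^sub>i x\<parallel>\<close> is countably subadditive because each \<open>T\<^sub>i\<close> is continuous.\<close>

lemma uniform_boundedness: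
  fixes T :: "'i \<Rightarrow> 'a::banach \<Rightarrow> 'b::banach"
  assumes lin: "\<And>i. i \<in> I \<Longrightarrow> bounded_linear (T i)"
    and bdd: "\<And>x. bounded ((\<lambda>i. T i x) ` I)"
  shows "\<exists>M. \<forall>i\<in>I. \<forall>x. norm (T i x) \<le> M * norm x"
proof (cases "I = {}")
  case False
  define p where "p x = (SUP i\<in>I. norm (T i x))" for x
  have bdd': "bdd_above ((\<lambda>i. norm (T i x)) ` I)" for x
    using bdd[of x] by (auto simp: bounded_iff bdd_above_def)
  have upper: "norm (T i x) \<le> p x" if "i \<in> I" for i x
    unfolding p_def by (rule cSUP_upper[OF that bdd'])
  have least: "p x \<le> c" if "\<And>i. i \<in> I \<Longrightarrow> norm (T i x) \<le> c" for x c
    unfolding p_def by (rule cSUP_least[OF False that])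
  have nonneg: "0 \<le> p x" for x
    using False upper norm_ge_zero order_trans by (metis all_not_in_conv)
  have le: "p (c *\<^sub>R x) \<le> \<bar>c\<bar> * p x" for c x
    by (rule least) (simp add: linear_cmul[OF bounded_linear.linear[OF lin]] mult_left_mono upper)
  have "\<exists>M. \<forall>x. p x \<le> M * norm x"
  proof (rule countably_subadditive_seminorm_bounded[OF nonneg])
    show "p (c *\<^sub>R x) = \<bar>c\<bar> * p x" for c x
    proof (cases "c = 0")
      case True
      then show ?thesis using le[of 0 x] nonneg[of "0 *\<^sub>R x"] by simp
    next
      case c: False
      have "p x \<le> \<bar>inverse c\<bar> * p (c *\<^sub>R x)"
        using le[of "inverse c" "c *\<^sub>R x"] c by simp
      then have "\<bar>c\<bar> * p x \<le> p (c *\<^sub>R x)" using c by (simp add: field_simps)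
      then show ?thesis using le[of c x] by simp
    qed
  next
    fix x :: "nat \<Rightarrow> 'a" and s
    assume summ: "summable (\<lambda>n. p (x n))" and s: "x sums s"
    show "p s \<le> (\<Sum>n. p (x n))"
    proof (rule least)
      fix i assume i: "i \<in> I"
      have norm_summ: "summable (\<lambda>n. norm (T i (x n)))"
        by (rule summable_comparison_test'[OF summ]) (use i upper in auto)
      have "T i s = (\<Sum>n. T i (x n))"
        using bounded_linear.sums[OF lin[OF i] s] by (rule sums_unique)
      then have "norm (T i s) \<le> (\<Sum>n. norm (T i (x n)))"
        using summable_norm[OF norm_summ] by simp
      also have "\<dots> \<le> (\<Sum>n. p (x n))"
        by (rule suminf_le) (use i upper summ norm_summ in auto)
      finally show "norm (T i s) \<le> (\<Sum>n. p (x n))" .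
    qed
  qed
  then show ?thesis using upper order_trans by blast
qed auto

text \<open>
  The seminorm \<open>\<parallel>f x\<parallel>\<close> is countably subadditive: if \<open>\<Sum> \<parallel>f x\<^sub>n\<parallel>\<close> converges, then so does \<open>\<Sum> f x\<^sub>n\<close>,
  and the closed graph identifies its sum as \<open>f (\<Sum> x\<^sub>n)\<close>.
\<close>

lemma closed_graph_bounded_linear:
  fixes f :: "'a::banach \<Rightarrow> 'b::banach"
  assumes "linear f"
    and closed: "\<And>x a b. x \<longlonglongrightarrow> a \<Longrightarrow> (\<lambda>n. f (x n)) \<longlonglongrightarrow> b \<Longrightarrow> f a = b"
  shows "bounded_linear f"
proof -
  interpret linear f by fact
  have "\<exists>M. \<forall>x. norm (f x) \<le> M * norm x"
  proof (rule countably_subadditive_seminorm_bounded)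
    fix x :: "nat \<Rightarrow> 'a" and s
    assume summ: "summable (\<lambda>n. norm (f (x n)))" and s: "x sums s"
    have "(\<lambda>n. f (x n)) sums (\<Sum>n. f (x n))"
      by (rule summable_sums[OF summable_norm_cancel[OF summ]])
    then have "f s = (\<Sum>n. f (x n))"
      using closed[of "\<lambda>n. sum x {..<n}"] s by (simp add: sums_def sum)
    then show "norm (f s) \<le> (\<Sum>n. norm (f (x n)))" using summable_norm[OF summ] by simp
  qed (simp_all add: scale)
  then show ?thesis
    by (metis assms(1) bounded_linear_axioms.intro bounded_linear_def mult.commute)
qed

section \<open>Nonautonomous linear differential equations\<close>

lemma continuous_has_primitive:
  fixes f :: "real \<Rightarrow> 'a::banach"
  assumes cont: "continuous_on UNIV f"
  shows "\<exists>F. F 0 = 0 \<and> (\<forall>t. (F has_vector_derivative f t) (at t))"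
proof -
  define F where "F t = (if 0 \<le> t then integral {0..t} f else - integral {t..0} f)" for t
  have int: "f integrable_on {a..b}" for a b
    using cont continuous_on_subset by (blast intro: integrable_continuous_real)
  have "(F has_vector_derivative f t) (at t)" for t
  proof -
    define c where "c = \<bar>t\<bar> + 1"
    have F_eq: "F s = integral {-c..s} f - integral {-c..0} f" if "s \<in> {-c<..<c}" for s
    proof (cases "0 \<le> s")
      case True
      then show ?thesis
        using that Henstock_Kurzweil_Integration.integral_combine[OF _ True int, of "-c"] by (simp add: F_def algebra_simps)
    next
      case False
      then show ?thesis
        using that Henstock_Kurzweil_Integration.integral_combine[OF _ _ int, of "-c" s 0] by (simp add: F_def algebra_simps)
    qed
    have t: "t \<in> {-c<..<c}" by (auto simp: c_def)
    have "((\<lambda>s. integral {-c..s} f) has_vector_derivative f t) (at t within {-c..c})"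
      by (rule integral_has_vector_derivative) (use cont continuous_on_subset t in auto)
    then have "((\<lambda>s. integral {-c..s} f) has_vector_derivative f t) (at t)"
      using t at_within_interior[of t "{-c..c}"] by (simp add: interior_atLeastAtMost_real)
    then have "((\<lambda>s. integral {-c..s} f - integral {-c..0} f) has_vector_derivative f t) (at t)"
      by (auto intro!: derivative_eq_intros)
    then show ?thesis
      by (rule has_vector_derivative_transform_within_open[of _ _ _ "{-c<..<c}"]) (use t F_eq in auto)
  qed
  moreover have "F 0 = 0" by (simp add: F_def)
  ultimately show ?thesis by blast
qed

lemma has_vector_derivative_zero_eq:
  fixes f :: "real \<Rightarrow> 'a::real_normed_vector"
  assumes "\<And>t. (f has_vector_derivative 0) (at t)"
  shows "f t = f 0"
proof -
  obtain c where "\<And>t. t \<in> UNIV \<Longrightarrow> f t = c"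
    by (rule has_vector_derivative_zero_constant[of UNIV f]) (use assms in auto)
  then show ?thesis by simp
qed

lemma has_vector_derivative_unique_primitive:
  fixes f g :: "real \<Rightarrow> 'a::real_normed_vector"
  assumes "\<And>t. (f has_vector_derivative h t) (at t)" "\<And>t. (g has_vector_derivative h t) (at t)"
    and "f 0 = g 0"
  shows "f t = g t"
proof -
  have "((\<lambda>t. f t - g t) has_vector_derivative 0) (at t)" for t
    using has_vector_derivative_diff[OF assms(1,2)] by simp
  from has_vector_derivative_zero_eq[OF this] assms(3) show ?thesis by simp
qed

text \<open>
  The weight \<open>exp (2 K \<bar>t\<bar>)\<close> makes integration gain a factor \<open>1/2\<close> after multiplication by \<open>K\<close>.
  This gain replaces the usual factorials: it closes the Gronwall estimate, and it makes the Picard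
  series below geometric.
\<close>

lemma norm_increment_exp_bound:
  fixes f :: "real \<Rightarrow> 'a::real_normed_vector"
  assumes der: "\<And>s. (f has_vector_derivative f' s) (at s)"
    and bnd: "\<And>s. \<bar>s\<bar> \<le> \<bar>t\<bar> \<Longrightarrow> norm (f' s) \<le> K * (c * exp (2 * K * \<bar>s\<bar>))"
    and "0 \<le> c"
  shows "norm (f t - f 0) \<le> c / 2 * exp (2 * K * \<bar>t\<bar>)"
proof -
  have pos: "norm (g \<tau> - g 0) \<le> c / 2 * exp (2 * K * \<tau>)"
    if der: "\<And>s. (g has_vector_derivative g' s) (at s)" and "0 < \<tau>"
      and bnd: "\<And>s. 0 < s \<Longrightarrow> s < \<tau> \<Longrightarrow> norm (g' s) \<le> K * (c * exp (2 * K * s))"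
    for g :: "real \<Rightarrow> 'a" and g' \<tau>
  proof -
    have "norm (g \<tau> - g 0) \<le> c / 2 * exp (2 * K * \<tau>) - c / 2 * exp (2 * K * 0)"
    proof (rule differentiable_bound_general[OF \<open>0 < \<tau>\<close> _ _ der])
      show "continuous_on {0..\<tau>} g"
        using der by (meson continuous_at_imp_continuous_on has_vector_derivative_continuous)
      show "continuous_on {0..\<tau>} (\<lambda>s. c / 2 * exp (2 * K * s))"
        by (intro continuous_intros)
      show "((\<lambda>s. c / 2 * exp (2 * K * s)) has_vector_derivative K * (c * exp (2 * K * s))) (at s)" for s
        unfolding has_real_derivative_iff_has_vector_derivative[symmetric]
        by (auto intro!: derivative_eq_intros)
    qed (use bnd in auto)
    then show ?thesis using \<open>0 \<le> c\<close> by simp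
  qed
  consider "t = 0" | "0 < t" | "t < 0" by linarith
  then show ?thesis
  proof cases
    case 2
    have "norm (f' s) \<le> K * (c * exp (2 * K * s))" if "0 < s" "s < t" for s
      using bnd[of s] that by simp
    from pos[OF der 2 this] 2 show ?thesis by simp
  next
    case 3
    have "((\<lambda>s. f (- s)) has_vector_derivative - f' (- s)) (at s)" for s
      using vector_diff_chain_at[of uminus "-1" s f "f' (- s)"] der
      by (simp add: o_def has_vector_derivative_minus[OF has_vector_derivative_id])
    moreover have "norm (- f' (- s)) \<le> K * (c * exp (2 * K * s))" if "0 < s" "s < - t" for s
      using bnd[of "- s"] that by simp
    ultimately show ?thesis using pos[of "\<lambda>s. f (- s)" "\<lambda>s. - f' (- s)" "- t"] 3 by simp
  qed (use \<open>0 \<le> c\<close> in auto)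
qed

text \<open>
  The maximum \<open>w m\<close> of \<open>\<parallel>q s\<parallel> exp (- 2 K \<bar>s\<bar>)\<close> over \<open>[-\<tau>, \<tau>]\<close> satisfies
  \<open>w m \<le> \<parallel>q 0\<parallel> + w m / 2\<close>, hence \<open>w m \<le> 2 \<parallel>q 0\<parallel>\<close>.
\<close>

lemma gronwall_two_sided:
  fixes q :: "real \<Rightarrow> 'a::real_normed_vector"
  assumes der: "\<And>s. (q has_vector_derivative q' s) (at s)"
    and bnd: "\<And>s. \<bar>s\<bar> \<le> \<tau> \<Longrightarrow> norm (q' s) \<le> K * norm (q s)"
    and K: "0 \<le> K" and t: "\<bar>t\<bar> \<le> \<tau>"
  shows "norm (q t) \<le> 2 * norm (q 0) * exp (2 * K * \<tau>)"
proof -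
  define w where "w s = norm (q s) * exp (- (2 * K * \<bar>s\<bar>))" for s
  have "continuous_on {-\<tau>..\<tau>} q"
    using der by (meson continuous_at_imp_continuous_on has_vector_derivative_continuous)
  then have "continuous_on {-\<tau>..\<tau>} w" unfolding w_def by (intro continuous_intros)
  then obtain m where "m \<in> {-\<tau>..\<tau>}" "\<forall>s\<in>{-\<tau>..\<tau>}. w s \<le> w m"
    using continuous_attains_sup[of "{-\<tau>..\<tau>}" w] order_trans[OF abs_ge_zero t] by auto
  then have m: "\<bar>m\<bar> \<le> \<tau>" "\<And>s. \<bar>s\<bar> \<le> \<tau> \<Longrightarrow> w s \<le> w m" by (auto simp: abs_le_iff)
  have q_le: "norm (q s) \<le> w m * exp (2 * K * \<bar>s\<bar>)" if "\<bar>s\<bar> \<le> \<tau>" for s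
    using m(2)[OF that] by (simp add: w_def exp_minus field_simps)
  have "0 \<le> w m" by (simp add: w_def)
  have "norm (q m - q 0) \<le> w m / 2 * exp (2 * K * \<bar>m\<bar>)"
  proof (rule norm_increment_exp_bound[OF der _ \<open>0 \<le> w m\<close>])
    show "norm (q' s) \<le> K * (w m * exp (2 * K * \<bar>s\<bar>))" if "\<bar>s\<bar> \<le> \<bar>m\<bar>" for s
      using bnd[of s] mult_left_mono[OF q_le K, of s] that m(1) by linarith
  qed
  then have "norm (q m) \<le> norm (q 0) + w m / 2 * exp (2 * K * \<bar>m\<bar>)"
    using norm_triangle_ineq2[of "q m" "q 0"] by linarith
  moreover have "norm (q m) = w m * exp (2 * K * \<bar>m\<bar>)" by (simp add: w_def exp_minus)
  ultimately have "w m * exp (2 * K * \<bar>m\<bar>) \<le> 2 * norm (q 0)" by simp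
  moreover have "w m * 1 \<le> w m * exp (2 * K * \<bar>m\<bar>)"
    using K \<open>0 \<le> w m\<close> by (intro mult_left_mono) auto
  ultimately have wm: "w m \<le> 2 * norm (q 0)" by linarith
  have "norm (q t) \<le> w m * exp (2 * K * \<bar>t\<bar>)" by (rule q_le[OF t])
  also have "\<dots> \<le> 2 * norm (q 0) * exp (2 * K * \<tau>)"
    using wm t K by (intro mult_mono) (auto intro: mult_left_mono)
  finally show ?thesis .
qed

text \<open>
  The solution is the Picard series \<open>\<Sum> q\<^sub>n\<close> with \<open>q\<^sub>0 = x\<close> and \<open>q\<^sub>n\<^sub>+\<^sub>1\<close> the primitive of \<open>Q q\<^sub>n\<close>.
  The family \<open>Q\<close> is only assumed to be strongly continuous and locally bounded, because
  \<open>t \<mapsto> T (- t) P (T t)\<close>, to which the lemma is applied, need not be continuous in operator norm.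
\<close>

lemma linear_ode_solution:
  fixes Q :: "real \<Rightarrow> 'a::banach \<Rightarrow> 'a"
  assumes lin: "\<And>t. bounded_linear (Q t)"
    and cont: "\<And>f. continuous_on UNIV f \<Longrightarrow> continuous_on UNIV (\<lambda>t. Q t (f t))"
    and bnd: "\<And>\<tau>. \<exists>K\<ge>0. \<forall>t x. \<bar>t\<bar> \<le> \<tau> \<longrightarrow> norm (Q t x) \<le> K * norm x"
  shows "\<exists>q. q 0 = x \<and> (\<forall>t. (q has_vector_derivative Q t (q t)) (at t))"
proof -
  define P where "P f = (SOME F. F 0 = 0 \<and> (\<forall>t. (F has_vector_derivative Q t (f t)) (at t)))" for f
  have P: "P f 0 = 0" "(P f has_vector_derivative Q t (f t)) (at t)" if "continuous_on UNIV f" for f t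
    using someI_ex[OF continuous_has_primitive[OF cont[OF that]]] unfolding P_def by auto
  define q where "q n = (P ^^ n) (\<lambda>t. x)" for n
  have q0: "q 0 = (\<lambda>t. x)" and q_Suc: "q (Suc n) = P (q n)" for n by (simp_all add: q_def)
  have q_cont: "continuous_on UNIV (q n)" for n
  proof (induction n)
    case (Suc n)
    then show ?case unfolding q_Suc using P(2)
      by (meson continuous_at_imp_continuous_on has_vector_derivative_continuous)
  qed (simp add: q0)
  have q_bound: "norm (q n t) \<le> norm x * (1/2)^n * exp (2 * K * \<tau>)"
    if K: "0 \<le> K" "\<And>t x. \<bar>t\<bar> \<le> \<tau> \<Longrightarrow> norm (Q t x) \<le> K * norm x" and t: "\<bar>t\<bar> \<le> \<tau>" for K \<tau> n t
  proof -
    have "norm (q n t) \<le> norm x * (1/2)^n * exp (2 * K * \<bar>t\<bar>)" if "\<bar>t\<bar> \<le> \<tau>" for t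
      using that
    proof (induction n arbitrary: t)
      case 0
      then show ?case using K(1) mult_left_mono[of 1 "exp (2 * K * \<bar>t\<bar>)" "norm x"] by (simp add: q0)
    next
      case (Suc n)
      have "norm (q (Suc n) t - q (Suc n) 0) \<le> (norm x * (1/2)^n) / 2 * exp (2 * K * \<bar>t\<bar>)"
      proof (rule norm_increment_exp_bound)
        show "(q (Suc n) has_vector_derivative Q s (q n s)) (at s)" for s
          unfolding q_Suc by (rule P(2)[OF q_cont])
        show "norm (Q s (q n s)) \<le> K * (norm x * (1/2)^n * exp (2 * K * \<bar>s\<bar>))" if "\<bar>s\<bar> \<le> \<bar>t\<bar>" for s
          using K(2)[of s "q n s"] mult_left_mono[OF Suc.IH[of s] K(1)] that Suc.prems by linarith
      qed simp
      then show ?case by (simp add: q_Suc P(1)[OF q_cont])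
    qed
    from this[OF t] show ?thesis
      using t K(1) by (elim order_trans) (auto intro!: mult_left_mono)
  qed
  define S where "S t = (\<Sum>n. q n t)" for t
  have "(S has_vector_derivative Q t (S t)) (at t)" for t
  proof -
    define \<tau> where "\<tau> = \<bar>t\<bar> + 1"
    obtain K where K: "0 \<le> K" "\<And>t x. \<bar>t\<bar> \<le> \<tau> \<Longrightarrow> norm (Q t x) \<le> K * norm x"
      using bnd[of \<tau>] by blast
    define C where "C = norm x * exp (2 * K * \<tau>)"
    have C: "0 \<le> C" by (simp add: C_def)
    have q_le: "norm (q n s) \<le> C * (1/2)^n" if "\<bar>s\<bar> \<le> \<tau>" for n s
      using q_bound[OF K that, of n] by (simp add: C_def mult_ac)
    have summ: "summable (\<lambda>n. norm (q n s))" if "\<bar>s\<bar> \<le> \<tau>" for s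
      by (rule summable_comparison_test'[where g = "\<lambda>n. C * (1/2::real)^n" and N = 0])
        (use q_le[OF that] in \<open>auto intro!: summable_mult summable_geometric\<close>)
    have sums: "(\<lambda>n. q n s) sums S s" if "\<bar>s\<bar> \<le> \<tau>" for s
      unfolding S_def by (rule summable_sums[OF summable_norm_cancel[OF summ[OF that]]])
    \<comment> \<open>The tails are uniformly small on \<open>[-\<tau>, \<tau>]\<close>, so the series may be differentiated term by term.\<close>
    have tail: "norm (S s - (\<Sum>i<n. q i s)) \<le> 2 * C * (1/2)^n" if s: "\<bar>s\<bar> \<le> \<tau>" for s n
    proof -
      have summ': "summable (\<lambda>i. norm (q (i + n) s))"
        using summ[OF s] by (rule summable_ignore_initial_segment)
      have "(\<lambda>i. C * (1/2)^n * (1/2::real)^i) sums (C * (1/2)^n * 2)"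
        using geometric_sums[of "1/2::real"] by (intro sums_mult) auto
      note geo = this
      have "S s - (\<Sum>i<n. q i s) = (\<Sum>i. q (i + n) s)"
        using suminf_minus_initial_segment[OF sums_summable[OF sums[OF s]], of n] by (simp add: S_def)
      also have "norm \<dots> \<le> (\<Sum>i. norm (q (i + n) s))" by (rule summable_norm[OF summ'])
      also have "\<dots> \<le> (\<Sum>i. C * (1/2)^n * (1/2::real)^i)"
        by (rule suminf_le[OF _ summ' sums_summable[OF geo]]) (use q_le[OF s, of "i + n" for i] in \<open>simp add: power_add mult_ac\<close>)
      also have "\<dots> = 2 * C * (1/2)^n" using sums_unique[OF geo] by simp
      finally show ?thesis .
    qed
    \<comment> \<open>The derivatives \<open>d\<close> of the terms are \<open>Q q\<^sub>n\<close> shifted by one index, so their first \<open>n + 1\<close> terms sum to \<open>Q\<close> of the \<open>n\<close>-th partial sum.\<close>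
    define d where "d n s = (case n of 0 \<Rightarrow> 0 | Suc m \<Rightarrow> Q s (q m s))" for n s
    have der: "(q n has_vector_derivative d n s) (at s)" for n s
      by (cases n) (simp_all add: d_def q0 q_Suc P(2)[OF q_cont])
    have d_sum: "(\<Sum>i<Suc n. d i s) = Q s (\<Sum>i<n. q i s)" for n s
      by (simp add: sum.lessThan_Suc_shift d_def linear_sum[OF bounded_linear.linear[OF lin]] del: sum.lessThan_Suc)
    have d_le: "norm ((\<Sum>i<Suc n. d i s) - Q s (S s)) \<le> K * (2 * C * (1/2)^n)" if "\<bar>s\<bar> \<le> \<tau>" for n s
    proof -
      have "norm ((\<Sum>i<Suc n. d i s) - Q s (S s)) = norm (Q s (S s - (\<Sum>i<n. q i s)))"
        unfolding d_sum by (simp add: linear_diff[OF bounded_linear.linear[OF lin]] norm_minus_commute)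
      also have "\<dots> \<le> K * norm (S s - (\<Sum>i<n. q i s))" by (rule K(2)[OF that])
      also have "\<dots> \<le> K * (2 * C * (1/2)^n)" by (rule mult_left_mono[OF tail[OF that] K(1)])
      finally show ?thesis .
    qed
    have "\<exists>g. \<forall>s\<in>{-\<tau><..<\<tau>}. (\<lambda>n. q n s) sums g s \<and>
        (g has_derivative (\<lambda>h. h *\<^sub>R Q s (S s))) (at s within {-\<tau><..<\<tau>})"
    proof (rule has_derivative_series[where f' = "\<lambda>n s h. h *\<^sub>R d n s" and x = t])
      show "(q n has_derivative (\<lambda>h. h *\<^sub>R d n s)) (at s within {-\<tau><..<\<tau>})" for n s
        using has_vector_derivative_at_within[OF der] unfolding has_vector_derivative_def .
      show "\<forall>\<^sub>F n in sequentially. \<forall>s\<in>{-\<tau><..<\<tau>}. \<forall>h.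
          norm ((\<Sum>i<n. h *\<^sub>R d i s) - h *\<^sub>R Q s (S s)) \<le> e * norm h" if "e > 0" for e
      proof -
        have "(\<lambda>n. K * (2 * C * (1/2::real)^n)) \<longlonglongrightarrow> 0"
          by (intro tendsto_mult_right_zero LIMSEQ_power_zero) auto
        then have "\<forall>\<^sub>F n in sequentially. K * (2 * C * (1/2::real)^n) < e"
          using \<open>e > 0\<close> by (rule order_tendstoD)
        then have "\<forall>\<^sub>F n in sequentially. \<forall>s\<in>{-\<tau><..<\<tau>}. \<forall>h.
          norm ((\<Sum>i<Suc n. h *\<^sub>R d i s) - h *\<^sub>R Q s (S s)) \<le> e * norm h"
        proof eventually_elim
          case (elim n)
          have "norm ((\<Sum>i<Suc n. h *\<^sub>R d i s) - h *\<^sub>R Q s (S s)) \<le> e * norm h"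
            if "s \<in> {-\<tau><..<\<tau>}" for s h
          proof -
            have le: "norm ((\<Sum>i<Suc n. d i s) - Q s (S s)) \<le> e"
              using order_trans[OF d_le[of s n] less_imp_le[OF elim]] that by (simp add: abs_le_iff)
            have "(\<Sum>i<Suc n. h *\<^sub>R d i s) - h *\<^sub>R Q s (S s) = h *\<^sub>R ((\<Sum>i<Suc n. d i s) - Q s (S s))"
              by (simp only: scaleR_right.sum scaleR_diff_right)
            then have "norm ((\<Sum>i<Suc n. h *\<^sub>R d i s) - h *\<^sub>R Q s (S s)) = norm ((\<Sum>i<Suc n. d i s) - Q s (S s)) * norm h"
              by (simp only: norm_scaleR real_norm_def mult.commute)
            also have "\<dots> \<le> e * norm h" by (rule mult_right_mono[OF le norm_ge_zero])
            finally show ?thesis .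
          qed
          then show ?case by blast
        qed
        then show ?thesis by (rule eventually_sequentially_Suc[THEN iffD1])
      qed
      show "(\<lambda>n. q n t) sums S t" by (rule sums) (simp add: \<tau>_def)
    qed (auto simp: \<tau>_def)
    then obtain g where g: "\<And>s. s \<in> {-\<tau><..<\<tau>} \<Longrightarrow> (\<lambda>n. q n s) sums g s"
        "\<And>s. s \<in> {-\<tau><..<\<tau>} \<Longrightarrow> (g has_derivative (\<lambda>h. h *\<^sub>R Q s (S s))) (at s within {-\<tau><..<\<tau>})"
      by blast
    have t: "t \<in> {-\<tau><..<\<tau>}" by (auto simp: \<tau>_def)
    have "(g has_vector_derivative Q t (S t)) (at t)"
      using g(2)[OF t] at_within_open[OF t] by (simp add: has_vector_derivative_def)
    moreover have "g s = S s" if "s \<in> {-\<tau><..<\<tau>}" for s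
      using sums_unique2[OF g(1)[OF that] sums[of s]] that by auto
    ultimately show ?thesis
      using t by (auto intro: has_vector_derivative_transform_within_open[of _ _ _ "{-\<tau><..<\<tau>}"])
  qed
  moreover have "S 0 = x"
  proof -
    have "q n 0 = (if n = 0 then x else 0)" for n
      by (cases n) (simp_all add: q0 q_Suc P(1)[OF q_cont])
    then show ?thesis
      using sums_unique[OF sums_If_finite[of "\<lambda>n. n = 0" "\<lambda>n. x"]] by (simp add: S_def)
  qed
  ultimately show ?thesis by blast
qed

section \<open>Strongly continuous groups and their generators\<close>

lemma has_vector_derivative_at_iff_quotient:
  fixes f :: "real \<Rightarrow> 'a::real_normed_vector"
  shows "(f has_vector_derivative d) (at t) \<longleftrightarrow> ((\<lambda>s. (f s - f t) /\<^sub>R (s - t)) \<longlongrightarrow> d) (at t)"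
proof -
  have eq: "norm ((f s - f t) - (s - t) *\<^sub>R d) / norm (s - t) = norm ((f s - f t) /\<^sub>R (s - t) - d)"
    if "s \<noteq> t" for s
  proof -
    have "(f s - f t) /\<^sub>R (s - t) - d = ((f s - f t) - (s - t) *\<^sub>R d) /\<^sub>R (s - t)"
      using that by (simp add: scaleR_diff_right)
    then show ?thesis by (simp add: divide_inverse mult.commute abs_inverse)
  qed
  have "(f has_vector_derivative d) (at t) \<longleftrightarrow>
      ((\<lambda>s. norm ((f s - f t) - (s - t) *\<^sub>R d) / norm (s - t)) \<longlongrightarrow> 0) (at t)"
    by (simp add: has_vector_derivative_def has_derivative_iff_norm bounded_linear_scaleR_left)
  also have "\<dots> \<longleftrightarrow> ((\<lambda>s. norm ((f s - f t) /\<^sub>R (s - t) - d)) \<longlongrightarrow> 0) (at t)"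
    by (rule filterlim_cong) (auto simp: eventually_at_filter eq[unfolded real_norm_def])
  also have "\<dots> \<longleftrightarrow> ((\<lambda>s. (f s - f t) /\<^sub>R (s - t)) \<longlongrightarrow> d) (at t)"
    by (simp add: tendsto_norm_zero_iff LIM_zero_iff)
  finally show ?thesis .
qed

lemma has_vector_derivative_shift:
  fixes f :: "real \<Rightarrow> 'a::real_normed_vector"
  shows "((\<lambda>s. f (s + c)) has_vector_derivative d) (at t) \<longleftrightarrow> (f has_vector_derivative d) (at (t + c))"
proof
  have id: "((\<lambda>s. s + c) has_vector_derivative 1) (at t)" for t c :: real
    by (auto intro!: derivative_eq_intros)
  show "((\<lambda>s. f (s + c)) has_vector_derivative d) (at t)" if "(f has_vector_derivative d) (at (t + c))"
    using vector_diff_chain_at[OF id that] by (simp add: o_def)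
  show "(f has_vector_derivative d) (at (t + c))" if "((\<lambda>s. f (s + c)) has_vector_derivative d) (at t)"
    using vector_diff_chain_at[OF id[of "- c" "t + c"], of "\<lambda>s. f (s + c)" d] that by (simp add: o_def)
qed

locale c0_group =
  fixes T :: "real \<Rightarrow> 'a::banach \<Rightarrow> 'a"
  assumes group: "strongly_continuous_group T"
begin

lemma bounded_linear_T: "bounded_linear (T t)"
  and T_zero [simp]: "T 0 x = x"
  and T_add: "T (s + t) x = T s (T t x)"
  and continuous_orbit: "continuous_on UNIV (\<lambda>t. T t x)"
  using group by (simp_all add: strongly_continuous_group_def)

lemmas linear_T = bounded_linear.linear[OF bounded_linear_T]

lemma T_minus_cancel [simp]: "T t (T (- t) x) = x" "T (- t) (T t x) = x"
  using T_add[of t "- t" x] T_add[of "- t" t x] by simp_all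

text \<open>Orbits of a compact time interval are compact, so the uniform boundedness principle applies.\<close>

lemma locally_bounded: "\<exists>K\<ge>0. \<forall>t x. \<bar>t\<bar> \<le> \<tau> \<longrightarrow> norm (T t x) \<le> K * norm x"
proof -
  have "\<exists>M. \<forall>t\<in>{-\<tau>..\<tau>}. \<forall>x. norm (T t x) \<le> M * norm x"
  proof (rule uniform_boundedness[OF bounded_linear_T])
    show "bounded ((\<lambda>t. T t x) ` {-\<tau>..\<tau>})" for x
      by (intro compact_imp_bounded compact_continuous_image continuous_on_subset[OF continuous_orbit]) auto
  qed
  then obtain M where M: "\<And>t x. t \<in> {-\<tau>..\<tau>} \<Longrightarrow> norm (T t x) \<le> M * norm x" by blast
  have "norm (T t x) \<le> \<bar>M\<bar> * norm x" if "\<bar>t\<bar> \<le> \<tau>" for t x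
    using M[of t x] that mult_right_mono[OF abs_ge_self[of M], of "norm x"] by (auto simp: abs_le_iff)
  then show ?thesis using abs_ge_zero by blast
qed

text \<open>Local boundedness upgrades strong continuity to joint continuity in time and vector.\<close>

lemma tendsto_T:
  assumes f: "(f \<longlongrightarrow> s) F" and g: "(g \<longlongrightarrow> a) F"
  shows "((\<lambda>x. T (f x) (g x)) \<longlongrightarrow> T s a) F"
proof -
  obtain K where K: "\<And>t x. \<bar>t\<bar> \<le> \<bar>s\<bar> + 1 \<Longrightarrow> norm (T t x) \<le> K * norm x"
    using locally_bounded[of "\<bar>s\<bar> + 1"] by blast
  have ev: "\<forall>\<^sub>F x in F. \<bar>f x\<bar> < \<bar>s\<bar> + 1"
    by (rule order_tendstoD(2)[OF tendsto_rabs[OF f]]) simp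
  have "((\<lambda>x. T (f x) (g x - a)) \<longlongrightarrow> 0) F"
  proof (rule Lim_null_comparison)
    show "\<forall>\<^sub>F x in F. norm (T (f x) (g x - a)) \<le> K * norm (g x - a)"
      using ev by eventually_elim (use K in auto)
    show "((\<lambda>x. K * norm (g x - a)) \<longlongrightarrow> 0) F"
      by (intro tendsto_mult_right_zero tendsto_norm_zero LIM_zero g)
  qed
  moreover have "((\<lambda>x. T (f x) a) \<longlongrightarrow> T s a) F"
    using continuous_orbit[of a] f by (auto intro: continuous_on_tendsto_compose)
  ultimately have "((\<lambda>x. T (f x) (g x - a) + T (f x) a) \<longlongrightarrow> 0 + T s a) F"
    by (rule tendsto_add)
  then show ?thesis by (simp add: linear_diff[OF linear_T])
qed

lemma continuous_on_T:
  assumes "continuous_on S f" "continuous_on S g"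
  shows "continuous_on S (\<lambda>x. T (f x) (g x))"
  using assms unfolding continuous_on_def by (blast intro: tendsto_T)

end

locale generated_group = c0_group T for T :: "real \<Rightarrow> 'a::banach \<Rightarrow> 'a" +
  fixes D :: "'a set" and G :: "'a \<Rightarrow> 'a"
  assumes generator: "((\<lambda>t. T t x) has_vector_derivative y) (at 0) \<longleftrightarrow> x \<in> D \<and> y = G x"
begin

lemma orbit_derivative:
  assumes "x \<in> D"
  shows "((\<lambda>s. T s x) has_vector_derivative T t (G x)) (at t)"
    and orbit_in_domain: "T t x \<in> D"
    and generator_commutes: "G (T t x) = T t (G x)"
proof -
  have "((\<lambda>s. T t (T s x)) has_vector_derivative T t (G x)) (at 0)"
    by (rule bounded_linear.has_vector_derivative[OF bounded_linear_T]) (use generator assms in blast)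
  then have *: "((\<lambda>s. T (s + t) x) has_vector_derivative T t (G x)) (at 0)"
    by (simp add: T_add[symmetric] add.commute)
  then show "((\<lambda>s. T s x) has_vector_derivative T t (G x)) (at t)"
    using has_vector_derivative_shift[of "\<lambda>s. T s x" t _ 0] by simp
  from * have "((\<lambda>s. T s (T t x)) has_vector_derivative T t (G x)) (at 0)"
    by (simp add: T_add)
  then show "T t x \<in> D" "G (T t x) = T t (G x)" using generator by auto
qed

lemma subspace_domain: "subspace D"
  and generator_add: "x \<in> D \<Longrightarrow> y \<in> D \<Longrightarrow> G (x + y) = G x + G y"
proof -
  have add: "x + y \<in> D \<and> G x + G y = G (x + y)" if "x \<in> D" "y \<in> D" for x y
  proof -
    have "((\<lambda>t. T t x + T t y) has_vector_derivative G x + G y) (at 0)"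
      by (rule has_vector_derivative_add) (use generator that in blast)+
    then show ?thesis using generator[of "x + y"] by (simp add: linear_add[OF linear_T])
  qed
  have scale: "c *\<^sub>R x \<in> D" if "x \<in> D" for c x
  proof -
    have "((\<lambda>t. c *\<^sub>R T t x) has_vector_derivative c *\<^sub>R G x) (at 0)"
      by (rule bounded_linear.has_vector_derivative[OF bounded_linear_scaleR_right])
        (use generator that in blast)
    then show ?thesis using generator[of "c *\<^sub>R x"] by (simp add: linear_cmul[OF linear_T])
  qed
  have "0 \<in> D" using generator[of 0 0] by (simp add: linear_0[OF linear_T])
  then show "subspace D" using add scale by (auto simp: subspace_def)
  show "x \<in> D \<Longrightarrow> y \<in> D \<Longrightarrow> G (x + y) = G x + G y" using add by simp
qed

lemma generator_diff: "x \<in> D \<Longrightarrow> y \<in> D \<Longrightarrow> G (x - y) = G x - G y"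
  using generator_add[of "x - y" y] subspace_diff[OF subspace_domain] by simp

text \<open>
  The product rule for \<open>T (- s) (z s)\<close>.  It turns a solution of \<open>z' = G z\<close> into a constant curve, which
  gives uniqueness of solutions.
\<close>

lemma pullback_derivative:
  assumes z: "(z has_vector_derivative z') (at t)" and "z t \<in> D"
  shows "((\<lambda>s. T (- s) (z s)) has_vector_derivative T (- t) (z' - G (z t))) (at t)"
proof -
  have neg: "(uminus has_vector_derivative - 1) (at t)" for t :: real
    by (auto intro!: derivative_eq_intros)
  have "((\<lambda>s. T (- s) (z t)) has_vector_derivative - T (- t) (G (z t))) (at t)"
    using vector_diff_chain_at[OF neg orbit_derivative(1)[OF \<open>z t \<in> D\<close>], of t] by (simp add: o_def)
  then have 1: "((\<lambda>s. (T (- s) (z t) - T (- t) (z t)) /\<^sub>R (s - t)) \<longlongrightarrow> - T (- t) (G (z t))) (at t)"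
    by (simp add: has_vector_derivative_at_iff_quotient)
  have 2: "((\<lambda>s. T (- s) ((z s - z t) /\<^sub>R (s - t))) \<longlongrightarrow> T (- t) z') (at t)"
    by (rule tendsto_T) (use z in \<open>auto simp: has_vector_derivative_at_iff_quotient intro!: tendsto_intros\<close>)
  have "((\<lambda>s. (T (- s) (z s) - T (- t) (z t)) /\<^sub>R (s - t)) \<longlongrightarrow> T (- t) z' + - T (- t) (G (z t))) (at t)"
    using tendsto_add[OF 2 1]
    by (simp add: linear_cmul[OF linear_T] linear_diff[OF linear_T] scaleR_diff_right)
  then show ?thesis
    by (simp add: has_vector_derivative_at_iff_quotient linear_diff[OF linear_T])
qed

lemma solution_is_orbit:
  assumes "\<And>t. z t \<in> D" and "\<And>t. (z has_vector_derivative G (z t)) (at t)"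
  shows "z t = T t (z 0)"
proof -
  have "((\<lambda>s. T (- s) (z s)) has_vector_derivative 0) (at s)" for s
    using pullback_derivative[OF assms(2,1)] by (simp add: linear_0[OF linear_T])
  then have "T (- t) (z t) = z 0"
    using has_vector_derivative_zero_eq[of "\<lambda>s. T (- s) (z s)" t] by simp
  then show ?thesis by (metis T_minus_cancel(1))
qed

text \<open>
  With \<open>F t = \<integral>\<^sub>0\<^sup>t T s x ds\<close> one has \<open>T h (F t) = F (t + h) - F h\<close>, which is differentiable in \<open>h\<close>
  although \<open>x\<close> is an arbitrary vector.  Such integrals are the source of elements of the domain.
\<close>

lemma orbit_primitive:
  assumes F: "F 0 = 0" "\<And>t. (F has_vector_derivative T t x) (at t)"
  shows "F t \<in> D" and "G (F t) = T t x - x"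
proof -
  have shift: "T h (F t) = F (t + h) - F h" for h
  proof (rule has_vector_derivative_unique_primitive[where f = "\<lambda>t. T h (F t)" and g = "\<lambda>t. F (t + h) - F h"])
    show "((\<lambda>t. T h (F t)) has_vector_derivative T (t + h) x) (at t)" for t
      using bounded_linear.has_vector_derivative[OF bounded_linear_T F(2), of h t]
      by (simp add: T_add[symmetric] add.commute)
    show "((\<lambda>t. F (t + h) - F h) has_vector_derivative T (t + h) x) (at t)" for t
      using has_vector_derivative_diff[OF iffD2[OF has_vector_derivative_shift F(2)] has_vector_derivative_const]
      by simp
  qed (simp add: F(1) linear_0[OF linear_T])
  have "((\<lambda>h. F (h + t)) has_vector_derivative T t x) (at 0)"
    using F(2)[of t] by (simp add: has_vector_derivative_shift)
  then have "((\<lambda>h. F (h + t) - F h) has_vector_derivative T t x - T 0 x) (at 0)"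
    by (rule has_vector_derivative_diff[OF _ F(2)])
  then have "((\<lambda>h. T h (F t)) has_vector_derivative T t x - x) (at 0)"
    by (simp add: shift add.commute)
  then show "F t \<in> D" "G (F t) = T t x - x" using generator by auto
qed

lemma dense_domain: "closure D = UNIV"
proof -
  have "x \<in> closure D" for x
  proof -
    obtain F where F: "F 0 = 0" "\<And>t. (F has_vector_derivative T t x) (at t)"
      using continuous_has_primitive[OF continuous_orbit] by blast
    have "((\<lambda>s. F s /\<^sub>R s) \<longlongrightarrow> x) (at 0)"
      using F(2)[of 0] by (simp add: has_vector_derivative_at_iff_quotient F(1))
    moreover have "F s /\<^sub>R s \<in> closure D" for s
      using orbit_primitive(1)[OF F] subspace_scale[OF subspace_domain] closure_subset by blast
    ultimately show ?thesis
      by (intro Lim_in_closed_set[OF closed_closure, of "\<lambda>s. F s /\<^sub>R s" D "at 0"]) auto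
  qed
  then show ?thesis by blast
qed

lemma rescaled_generated_group:
  "generated_group (\<lambda>t x. exp (c * t) *\<^sub>R T t x) D (\<lambda>x. G x + c *\<^sub>R x)"
proof
  have scaled: "((\<lambda>t. exp (c * t) *\<^sub>R f t) has_vector_derivative d + c *\<^sub>R f 0) (at 0)"
    if "(f has_vector_derivative d) (at 0)" for f :: "real \<Rightarrow> 'a" and c d
  proof -
    have "((\<lambda>t. exp (c * t)) has_field_derivative c) (at 0)"
      by (auto intro!: derivative_eq_intros)
    from has_vector_derivative_scaleR[OF this that] show ?thesis by simp
  qed
  show "strongly_continuous_group (\<lambda>t x. exp (c * t) *\<^sub>R T t x)"
    unfolding strongly_continuous_group_def
  proof (intro conjI allI)
    show "bounded_linear (\<lambda>x. exp (c * t) *\<^sub>R T t x)" for t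
      by (rule bounded_linear_compose[OF bounded_linear_scaleR_right bounded_linear_T])
    show "(\<lambda>x. exp (c * (s + t)) *\<^sub>R T (s + t) x) =
        (\<lambda>x. exp (c * s) *\<^sub>R T s x) \<circ> (\<lambda>x. exp (c * t) *\<^sub>R T t x)" for s t
      by (auto simp: T_add linear_cmul[OF linear_T] exp_add distrib_left)
    show "continuous_on UNIV (\<lambda>t. exp (c * t) *\<^sub>R T t x)" for x
      by (intro continuous_intros continuous_orbit)
  qed auto
  show "((\<lambda>t. exp (c * t) *\<^sub>R T t x) has_vector_derivative y) (at 0) \<longleftrightarrow> x \<in> D \<and> y = G x + c *\<^sub>R x" for x y
  proof
    assume "((\<lambda>t. exp (c * t) *\<^sub>R T t x) has_vector_derivative y) (at 0)"
    from scaled[OF this, of "- c"]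
    have "((\<lambda>t. T t x) has_vector_derivative y - c *\<^sub>R x) (at 0)"
      by (simp add: mult_exp_exp)
    then show "x \<in> D \<and> y = G x + c *\<^sub>R x" using generator[of x "y - c *\<^sub>R x"] by (simp add: algebra_simps)
  next
    assume "x \<in> D \<and> y = G x + c *\<^sub>R x"
    then show "((\<lambda>t. exp (c * t) *\<^sub>R T t x) has_vector_derivative y) (at 0)"
      using scaled[of "\<lambda>t. T t x" "G x" c] generator by auto
  qed
qed

text \<open>
  Instead of a Laplace transform over the half line, an integral over \<open>[0, 1]\<close> suffices.  For large \<open>l\<close>
  the operator \<open>U 1\<close> of the rescaled group \<open>U t = exp (- l t) T t\<close> is a contraction, so \<open>x = y + U 1 x\<close>
  is solvable for every \<open>y\<close>, and \<open>F = \<integral>\<^sub>0\<^sup>1 U s x ds\<close> satisfies \<open>(G - l) F = U 1 x - x = - y\<close>.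
  A vector in the kernel of \<open>G - l\<close> is fixed by \<open>U 1\<close>, hence zero.
\<close>

lemma generator_has_resolvent:
  "\<exists>l. \<forall>y. \<exists>!x. x \<in> D \<and> l *\<^sub>R x - G x = y"
proof -
  obtain K where K: "0 \<le> K" "\<And>x. norm (T 1 x) \<le> K * norm x"
    using locally_bounded[of 1] by auto
  \<comment> \<open>The choice gives \<open>exp (- l) K \<le> 1/2\<close>.\<close>
  define l where "l = ln (2 * K + 2)"
  interpret U: generated_group "\<lambda>t x. exp (- l * t) *\<^sub>R T t x" D "\<lambda>x. G x + (- l) *\<^sub>R x"
    by (rule rescaled_generated_group)
  let ?U = "\<lambda>x. exp (- l * 1) *\<^sub>R T 1 x"
  have contraction: "norm (?U x) \<le> 1/2 * norm x" for x
  proof -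
    have "norm (?U x) = norm (T 1 x) / (2 * K + 2)"
      using K(1) by (simp add: l_def exp_minus field_simps)
    also have "\<dots> \<le> K * norm x / (2 * K + 2)" using K by (intro divide_right_mono) auto
    also have "\<dots> \<le> 1/2 * norm x" using K(1) by (simp add: field_simps)
    finally show ?thesis .
  qed
  have "\<exists>!x. x \<in> D \<and> l *\<^sub>R x - G x = y" for y
  proof (rule ex_ex1I)
    have "\<exists>!x. y + ?U x = x"
    proof (rule banach_fix_type[of "1/2"])
      show "\<forall>a b. dist (y + ?U a) (y + ?U b) \<le> 1/2 * dist a b"
      proof (intro allI)
        fix a b
        have "(y + ?U a) - (y + ?U b) = ?U (a - b)"
          by (simp add: linear_diff[OF linear_T] scaleR_diff_right)
        then show "dist (y + ?U a) (y + ?U b) \<le> 1/2 * dist a b"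
          unfolding dist_norm using contraction by metis
      qed
    qed auto
    then obtain x where x: "y + ?U x = x" by blast
    obtain F where F: "F 0 = 0" "\<And>t. (F has_vector_derivative exp (- l * t) *\<^sub>R T t x) (at t)"
      using continuous_has_primitive[OF U.continuous_orbit] by blast
    have "F 1 \<in> D" "G (F 1) + (- l) *\<^sub>R F 1 = ?U x - x" using U.orbit_primitive[OF F] by auto
    then have "l *\<^sub>R F 1 - G (F 1) = x - ?U x" by (simp add: algebra_simps)
    also have "\<dots> = y" using x by (metis add_diff_cancel_right')
    finally show "\<exists>x. x \<in> D \<and> l *\<^sub>R x - G x = y" using \<open>F 1 \<in> D\<close> by blast
  next
    fix x x' assume x: "x \<in> D \<and> l *\<^sub>R x - G x = y" and x': "x' \<in> D \<and> l *\<^sub>R x' - G x' = y"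
    define d where "d = x - x'"
    have d: "d \<in> D" using x x' subspace_diff[OF subspace_domain] by (auto simp: d_def)
    have "G d + (- l) *\<^sub>R d = 0" using x x' by (simp add: d_def generator_diff algebra_simps)
    then have "((\<lambda>t. exp (- l * t) *\<^sub>R T t d) has_vector_derivative 0) (at t)" for t
      using U.orbit_derivative(1)[OF d, of t] by (simp add: linear_0[OF linear_T])
    from has_vector_derivative_zero_eq[OF this, of 1] have "?U d = d" by simp
    then have "norm d \<le> 1/2 * norm d" using contraction[of d] by simp
    then show "x = x'" by (simp add: d_def)
  qed
  then show ?thesis by blast
qed

end

section \<open>Constructions with generators\<close>

lemma generates_group_iff: "generates_group D G \<longleftrightarrow> (\<exists>T. generated_group T D G)"
  by (simp add: generates_group_def generated_group_def generated_group_axioms_def c0_group_def)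

text \<open>
  Substituting \<open>S t x = T t (q t)\<close> into \<open>z' = G z + P z\<close> removes the unbounded operator formally: \<open>q\<close>
  solves \<open>q' = Q t q\<close> with the bounded operators \<open>Q t = T (- t) P (T t)\<close>.  The equation for \<open>q\<close> makes
  sense for every initial vector, so it defines \<open>S t\<close> on the whole space.  Uniqueness for this
  equation makes \<open>S\<close> a group of linear operators, and at \<open>t = 0\<close> the curves \<open>S t x\<close> and \<open>T t x\<close> differ
  by a curve with derivative \<open>P x\<close>, so that the generator of \<open>S\<close> is \<open>G + P\<close> with unchanged domain.
\<close>

lemma bounded_perturbation_generates_group:
  fixes G :: "'a::banach \<Rightarrow> 'a"
  assumes "generates_group D G" and P: "bounded_linear P"
  shows "generates_group D (\<lambda>x. G x + P x)"
proof -
  obtain T where "generated_group T D G" using assms(1) generates_group_iff by blast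
  then interpret generated_group T D G .
  define Q where "Q t x = T (- t) (P (T t x))" for t x
  have Q_lin: "bounded_linear (Q t)" for t
    unfolding Q_def
    by (intro bounded_linear_compose[OF bounded_linear_T] bounded_linear_compose[OF P] bounded_linear_T)
  note Q_linear = bounded_linear.linear[OF Q_lin]
  have Q_bdd: "\<exists>K\<ge>0. \<forall>t x. \<bar>t\<bar> \<le> \<tau> \<longrightarrow> norm (Q t x) \<le> K * norm x" for \<tau>
  proof -
    obtain K where K: "0 \<le> K" "\<And>t x. \<bar>t\<bar> \<le> \<tau> \<Longrightarrow> norm (T t x) \<le> K * norm x"
      using locally_bounded by blast
    obtain M where M: "0 \<le> M" "\<And>x. norm (P x) \<le> norm x * M"
      using bounded_linear.nonneg_bounded[OF P] by blast
    have "norm (Q t x) \<le> K * (M * K) * norm x" if "\<bar>t\<bar> \<le> \<tau>" for t x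
    proof -
      have "norm (Q t x) \<le> K * norm (P (T t x))" unfolding Q_def by (rule K(2)) (use that in simp)
      also have "\<dots> \<le> K * (norm (T t x) * M)" by (rule mult_left_mono[OF M(2) K(1)])
      also have "\<dots> \<le> K * ((K * norm x) * M)"
        by (intro mult_left_mono mult_right_mono K M that)
      finally show ?thesis by (simp add: mult_ac)
    qed
    moreover have "0 \<le> K * (M * K)" using K(1) M(1) by simp
    ultimately show ?thesis by blast
  qed
  have "\<exists>q. q 0 = x \<and> (\<forall>t. (q has_vector_derivative Q t (q t)) (at t))" for x
  proof (rule linear_ode_solution[OF Q_lin _ Q_bdd])
    show "continuous_on UNIV (\<lambda>t. Q t (f t))" if "continuous_on UNIV f" for f
      unfolding Q_def using that
      by (intro continuous_on_T continuous_intros bounded_linear.continuous_on[OF P])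
  qed
  then obtain q where q_0: "\<And>x. q x 0 = x"
    and q_der: "\<And>x t. (q x has_vector_derivative Q t (q x t)) (at t)" by metis
  have q_bound: "\<exists>C. \<forall>f. (\<forall>s. (f has_vector_derivative Q s (f s)) (at s)) \<longrightarrow> norm (f t) \<le> norm (f 0) * C"
    for t
  proof -
    obtain K where K: "0 \<le> K" "\<And>s x. \<bar>s\<bar> \<le> \<bar>t\<bar> \<Longrightarrow> norm (Q s x) \<le> K * norm x"
      using Q_bdd[of "\<bar>t\<bar>"] by blast
    have "norm (f t) \<le> 2 * norm (f 0) * exp (2 * K * \<bar>t\<bar>)"
      if "\<And>s. (f has_vector_derivative Q s (f s)) (at s)" for f
      by (rule gronwall_two_sided[OF that K(2) K(1)]) auto
    then show ?thesis
      by (intro exI[of _ "2 * exp (2 * K * \<bar>t\<bar>)"]) (auto simp: mult_ac)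
  qed
  have q_unique: "f t = q (f 0) t" if f: "\<And>s. (f has_vector_derivative Q s (f s)) (at s)" for f t
  proof -
    have "((\<lambda>s. f s - q (f 0) s) has_vector_derivative Q s (f s - q (f 0) s)) (at s)" for s
      using has_vector_derivative_diff[OF f q_der] by (simp add: linear_diff[OF Q_linear])
    with q_bound[of t] obtain C where "norm (f t - q (f 0) t) \<le> norm (f 0 - q (f 0) 0) * C"
      by blast
    then show ?thesis by (simp add: q_0)
  qed
  have q_lin: "bounded_linear (\<lambda>x. q x t)" for t
  proof -
    obtain C where C: "\<And>x. norm (q x t) \<le> norm x * C"
      using q_bound[of t] q_der q_0 by metis
    show ?thesis
    proof (rule bounded_linear_intro[OF _ _ C])
      show "q (x + y) t = q x t + q y t" for x y
      proof -
        have "((\<lambda>s. q x s + q y s) has_vector_derivative Q s (q x s + q y s)) (at s)" for s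
          using has_vector_derivative_add[OF q_der q_der] by (simp add: linear_add[OF Q_linear])
        from q_unique[OF this, of t] show ?thesis by (simp add: q_0)
      qed
      show "q (c *\<^sub>R x) t = c *\<^sub>R q x t" for c x
      proof -
        have "((\<lambda>s. c *\<^sub>R q x s) has_vector_derivative Q s (c *\<^sub>R q x s)) (at s)" for s
          using bounded_linear.has_vector_derivative[OF bounded_linear_scaleR_right q_der]
          by (simp add: linear_cmul[OF Q_linear])
        from q_unique[OF this, of t] show ?thesis by (simp add: q_0)
      qed
    qed
  qed
  define S where "S t x = T t (q x t)" for t x
  have S_0: "S 0 x = x" for x by (simp add: S_def q_0)
  have S_add: "S (t + s) x = S t (S s x)" for s t x
  proof -
    \<comment> \<open>After the time shift by \<open>s\<close>, \<open>T s\<close> conjugates \<open>Q (t + s)\<close> into \<open>Q t\<close>, so the shifted curve solves the same equation.\<close>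
    have "((\<lambda>t. T s (q x (t + s))) has_vector_derivative Q t (T s (q x (t + s)))) (at t)" for t
    proof -
      have "((\<lambda>t. T s (q x (t + s))) has_vector_derivative T s (Q (t + s) (q x (t + s)))) (at t)"
        by (rule bounded_linear.has_vector_derivative[OF bounded_linear_T])
          (simp add: has_vector_derivative_shift q_der)
      moreover have "T s (Q (t + s) y) = Q t (T s y)" for y
        by (simp add: Q_def T_add[symmetric])
      ultimately show ?thesis by simp
    qed
    from q_unique[OF this, of t] have "T s (q x (t + s)) = q (S s x) t" by (simp add: S_def)
    then show ?thesis by (simp add: S_def T_add)
  qed
  have "strongly_continuous_group S"
    unfolding strongly_continuous_group_def
  proof (intro conjI allI)
    show "bounded_linear (S t)" for t
      unfolding S_def by (rule bounded_linear_compose[OF bounded_linear_T q_lin])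
    have "continuous_on UNIV (q x)" for x
      using q_der by (meson continuous_at_imp_continuous_on has_vector_derivative_continuous)
    then show "continuous_on UNIV (\<lambda>t. S t x)" for x
      unfolding S_def by (intro continuous_on_T continuous_intros)
  qed (auto simp: S_0 S_add)
  moreover have "((\<lambda>t. S t x) has_vector_derivative y) (at 0) \<longleftrightarrow> x \<in> D \<and> y = G x + P x" for x y
  proof -
    have "((\<lambda>s. T s ((q x s - q x 0) /\<^sub>R (s - 0))) \<longlongrightarrow> T 0 (Q 0 (q x 0))) (at 0)"
      using q_der[of x 0] by (intro tendsto_T) (auto simp: has_vector_derivative_at_iff_quotient)
    then have diff: "((\<lambda>s. S s x - T s x) has_vector_derivative P x) (at 0)"
      by (simp add: has_vector_derivative_at_iff_quotient q_0 S_def Q_def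
          linear_cmul[OF linear_T] linear_diff[OF linear_T])
    have "((\<lambda>t. S t x) has_vector_derivative y) (at 0) \<longleftrightarrow> ((\<lambda>t. T t x) has_vector_derivative y - P x) (at 0)"
      using has_vector_derivative_add[OF diff, of "\<lambda>t. T t x" "y - P x"]
        has_vector_derivative_diff[OF _ diff, of "\<lambda>t. S t x" y] by auto
    then show ?thesis by (auto simp: generator algebra_simps)
  qed
  ultimately show ?thesis unfolding generates_group_def by blast
qed

lemma generates_group_similar:
  fixes \<Phi> :: "'a::banach \<Rightarrow> 'b::banach"
  assumes "generates_group D G" and \<Phi>: "bounded_linear \<Phi>" and \<Psi>: "bounded_linear \<Psi>"
    and inv: "\<And>x. \<Psi> (\<Phi> x) = x" "\<And>y. \<Phi> (\<Psi> y) = y"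
  shows "generates_group {y. \<Psi> y \<in> D} (\<lambda>y. \<Phi> (G (\<Psi> y)))"
proof -
  obtain T where "generated_group T D G" using assms(1) generates_group_iff by blast
  then interpret generated_group T D G .
  have "strongly_continuous_group (\<lambda>t y. \<Phi> (T t (\<Psi> y)))"
    unfolding strongly_continuous_group_def
  proof (intro conjI allI)
    show "bounded_linear (\<lambda>y. \<Phi> (T t (\<Psi> y)))" for t
      by (intro bounded_linear_compose[OF \<Phi>] bounded_linear_compose[OF bounded_linear_T] \<Psi>)
    show "continuous_on UNIV (\<lambda>t. \<Phi> (T t (\<Psi> y)))" for y
      by (intro bounded_linear.continuous_on[OF \<Phi>] continuous_orbit)
  qed (auto simp: inv T_add)
  moreover have "((\<lambda>t. \<Phi> (T t (\<Psi> x))) has_vector_derivative y) (at 0) \<longleftrightarrow>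
      x \<in> {y. \<Psi> y \<in> D} \<and> y = \<Phi> (G (\<Psi> x))" for x y
  proof -
    have "((\<lambda>t. \<Phi> (T t (\<Psi> x))) has_vector_derivative y) (at 0) \<longleftrightarrow>
        ((\<lambda>t. T t (\<Psi> x)) has_vector_derivative \<Psi> y) (at 0)"
      using bounded_linear.has_vector_derivative[OF \<Psi>, of "\<lambda>t. \<Phi> (T t (\<Psi> x))" y "at 0"]
        bounded_linear.has_vector_derivative[OF \<Phi>, of "\<lambda>t. T t (\<Psi> x)" "\<Psi> y" "at 0"]
      by (auto simp: inv)
    then show ?thesis using inv by (auto simp: generator) metis
  qed
  ultimately show ?thesis unfolding generates_group_def by blast
qed

lemma has_vector_derivative_Pair_iff:
  "((\<lambda>t. (f t, g t)) has_vector_derivative (a, b)) (at x within S) \<longleftrightarrow>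
    (f has_vector_derivative a) (at x within S) \<and> (g has_vector_derivative b) (at x within S)"
proof
  assume *: "((\<lambda>t. (f t, g t)) has_vector_derivative (a, b)) (at x within S)"
  show "(f has_vector_derivative a) (at x within S) \<and> (g has_vector_derivative b) (at x within S)"
    using bounded_linear.has_vector_derivative[OF bounded_linear_fst *]
      bounded_linear.has_vector_derivative[OF bounded_linear_snd *] by simp
qed (simp add: has_vector_derivative_Pair)

lemma generates_group_times_trivial:
  fixes G :: "'a::banach \<Rightarrow> 'a"
  assumes "generates_group D G"
  shows "generates_group (D \<times> (UNIV :: 'b::banach set)) (\<lambda>(x, p). (G x, 0))"
proof -
  obtain T where "generated_group T D G" using assms generates_group_iff by blast
  then interpret generated_group T D G .
  let ?S = "\<lambda>t (x, p :: 'b). (T t x, p)"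
  have "strongly_continuous_group ?S"
    unfolding strongly_continuous_group_def
  proof (intro conjI allI)
    show "bounded_linear (?S t)" for t
      unfolding case_prod_beta
      by (intro bounded_linear_Pair bounded_linear_compose[OF bounded_linear_T] bounded_linear_fst bounded_linear_snd)
    show "continuous_on UNIV (\<lambda>t. ?S t z)" for z
      by (cases z) (auto intro!: continuous_on_Pair continuous_orbit)
  qed (auto simp: T_add)
  moreover have "((\<lambda>t. ?S t z) has_vector_derivative w) (at 0) \<longleftrightarrow>
      z \<in> D \<times> UNIV \<and> w = (case z of (x, p) \<Rightarrow> (G x, 0))" for z w
  proof (cases z; cases w)
    fix x p y r assume zw: "z = (x, p)" "w = (y, r)"
    have "((\<lambda>t. p) has_vector_derivative r) (at (0::real)) \<longleftrightarrow> r = 0"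
      using vector_derivative_unique_at[OF _ has_vector_derivative_const] by auto
    then show ?thesis by (auto simp: zw has_vector_derivative_Pair_iff generator)
  qed
  ultimately show ?thesis unfolding generates_group_def by blast
qed

lemma generates_group_cong:
  assumes "D = D'" and "\<And>x. x \<in> D' \<Longrightarrow> G x = G' x"
  shows "generates_group D G \<longleftrightarrow> generates_group D' G'"
  unfolding generates_group_def using assms by metis

section \<open>The abstract initial-boundary value problem\<close>

text \<open>
  Along an orbit of a vector of the domain, membership in the graph of \<open>R\<close> is the boundary condition
  \<open>x = R u\<close>.  In particular \<open>R u\<close> is the last component of a \<open>C\<^sup>1\<close> curve, which \<open>u \<in> C\<^sup>1\<close> alone
  would not give for an unbounded \<open>R\<close>.
\<close>

lemma well_posed_if_generates_group:
  fixes G :: "'e::banach \<Rightarrow> 'e" and R B :: "'e \<Rightarrow> 'f::banach"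
  assumes "generates_group {(u, R u) | u. u \<in> D} (\<lambda>(u, x). (G u, B u + Bt x))"
  shows "well_posed D G R B Bt"
proof -
  let ?D = "{(u, R u) | u. u \<in> D}" and ?G = "\<lambda>(u, x). (G u, B u + Bt x)"
  obtain T where "generated_group T ?D ?G" using assms generates_group_iff by blast
  then interpret generated_group T ?D ?G .
  have orbit: "(u t, R (u t)) = T t (u0, R u0)" if "classical_solution D G R B Bt u0 (R u0) u" for u u0 t
  proof -
    have "(u t, R (u t)) = T t (u 0, R (u 0))"
      by (rule solution_is_orbit)
        (use that in \<open>auto simp: classical_solution_def Let_def has_vector_derivative_Pair_iff\<close>)
    then show ?thesis using that by (simp add: classical_solution_def Let_def)
  qed
  have solution: "classical_solution D G R B Bt u0 (R u0) (\<lambda>t. fst (T t (u0, R u0)))" if "u0 \<in> D" for u0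
  proof -
    define z where "z t = T t (u0, R u0)" for t
    have dom: "(u0, R u0) \<in> ?D" using that by blast
    have z_dom: "fst (z t) \<in> D" "R (fst (z t)) = snd (z t)" for t
      using orbit_in_domain[OF dom, of t] by (auto simp: z_def)
    have z_der: "(z has_vector_derivative T t (?G (u0, R u0))) (at t)"
      and z_G: "T t (?G (u0, R u0)) = ?G (z t)" for t
      using orbit_derivative[OF dom, of t] generator_commutes[OF dom, of t] by (auto simp: z_def[abs_def])
    have cont: "continuous_on UNIV (\<lambda>t. T t (?G (u0, R u0)))" by (rule continuous_orbit)
    have fst_der: "((\<lambda>t. fst (z t)) has_vector_derivative fst (T t (?G (u0, R u0)))) (at t)"
      and snd_der: "((\<lambda>t. snd (z t)) has_vector_derivative snd (T t (?G (u0, R u0)))) (at t)" for t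
      using bounded_linear.has_vector_derivative[OF bounded_linear_fst z_der]
        bounded_linear.has_vector_derivative[OF bounded_linear_snd z_der] by auto
    have "(\<lambda>t. fst (z t)) C1_differentiable_on UNIV" "(\<lambda>t. snd (z t)) C1_differentiable_on UNIV"
      unfolding C1_differentiable_on_def
      using fst_der snd_der continuous_on_fst[OF cont] continuous_on_snd[OF cont] by (meson UNIV_I)+
    moreover have "((\<lambda>t. fst (z t)) has_vector_derivative G (fst (z t))) (at t)"
      "((\<lambda>t. snd (z t)) has_vector_derivative B (fst (z t)) + Bt (snd (z t))) (at t)" for t
      using fst_der[of t] snd_der[of t] unfolding z_G by (simp_all add: case_prod_beta)
    ultimately show ?thesis
      unfolding classical_solution_def Let_def z_def[symmetric] z_dom(2)
      using z_dom by (simp add: z_def)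
  qed
  show ?thesis
    unfolding well_posed_def
  proof (intro conjI ballI allI impI)
    fix u0 assume u0: "u0 \<in> D"
    show "\<exists>!u. classical_solution D G R B Bt u0 (R u0) u"
    proof (rule ex1I)
      show "classical_solution D G R B Bt u0 (R u0) (\<lambda>t. fst (T t (u0, R u0)))" by (rule solution[OF u0])
      show "u = (\<lambda>t. fst (T t (u0, R u0)))" if "classical_solution D G R B Bt u0 (R u0) u" for u
        using orbit[OF that] by (metis fst_conv)
    qed
    fix u and a b \<epsilon> :: real
    assume u: "classical_solution D G R B Bt u0 (R u0) u" and "\<epsilon> > 0"
    obtain K where K: "0 \<le> K" "\<And>t z. \<bar>t\<bar> \<le> max \<bar>a\<bar> \<bar>b\<bar> \<Longrightarrow> norm (T t z) \<le> K * norm z"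
      using locally_bounded by blast
    show "\<exists>\<delta>>0. \<forall>v0\<in>D. \<forall>v. classical_solution D G R B Bt v0 (R v0) v \<longrightarrow>
        dist (v0, R v0) (u0, R u0) < \<delta> \<longrightarrow> (\<forall>t\<in>{a..b}. dist (v t, R (v t)) (u t, R (u t)) < \<epsilon>)"
    proof (intro exI[of _ "\<epsilon> / (K + 1)"] conjI ballI allI impI)
      show "0 < \<epsilon> / (K + 1)" using \<open>\<epsilon> > 0\<close> K(1) by simp
      fix v0 v t assume v: "classical_solution D G R B Bt v0 (R v0) v"
        and close: "dist (v0, R v0) (u0, R u0) < \<epsilon> / (K + 1)" and t: "t \<in> {a..b}"
      have "dist (v t, R (v t)) (u t, R (u t)) = norm (T t ((v0, R v0) - (u0, R u0)))"
        unfolding orbit[OF u] orbit[OF v] dist_norm linear_diff[OF linear_T] ..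
      also have "\<dots> \<le> K * dist (v0, R v0) (u0, R u0)"
        unfolding dist_norm by (rule K(2)) (use t in auto)
      also have "\<dots> \<le> (K + 1) * dist (v0, R v0) (u0, R u0)" by (intro mult_right_mono) auto
      also have "\<dots> < \<epsilon>" using close K(1) by (simp add: field_simps)
      finally show "dist (v t, R (v t)) (u t, R (u t)) < \<epsilon>" .
    qed
  qed (rule dense_domain)
qed

text \<open>
  \<open>E\<close> is the Dirichlet operator at \<open>l\<^sup>2\<close>.  For \<open>w\<close> with \<open>R w = x\<close> one corrects \<open>w\<close> by the \<open>w\<^sub>0\<close> in the kernel
  of \<open>R\<close> with \<open>(l\<^sup>2 - A) w\<^sub>0 = (l\<^sup>2 - A) w\<close>, and then \<open>E x = w - w\<^sub>0\<close>.  Such \<open>w\<^sub>0\<close> exists and is unique because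
  the equation \<open>l z - (v, A u) = (0, f)\<close> for \<open>z = (u, v)\<close> in the phase space is equivalent to
  \<open>v = l u\<close>, \<open>l\<^sup>2 u - A u = f\<close>.  For the closed graph theorem, note that \<open>A (E x\<^sub>n) = l\<^sup>2 E x\<^sub>n\<close>
  converges in \<open>X\<close> as soon as \<open>E x\<^sub>n\<close> converges in \<open>Y\<close>.
\<close>

lemma dirichlet_operator_exists:
  fixes j :: "'y::banach \<Rightarrow> 'x::banach" and A :: "'y \<Rightarrow> 'x" and R :: "'y \<Rightarrow> 'b::banach"
  assumes j: "continuous_embedding j"
    and A: "linear_operator_on DA A" and R: "linear_operator_on DA R" and surj: "R ` DA = UNIV"
    and closed: "closed_operator DA (\<lambda>u. (A u, R u))"
    and gen: "generates_cosine_with_phase_space j {u \<in> DA. R u = 0} A"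
  shows "\<exists>l E. bounded_linear E \<and> (\<forall>x. E x \<in> DA \<and> R (E x) = x \<and> A (E x) = (l * l) *\<^sub>R j (E x))"
proof -
  let ?D0 = "{u \<in> DA. R u = 0}"
  have inj: "inv j (j u) = u" for u using j by (simp add: continuous_embedding_def)
  have j_lin: "bounded_linear j" using j by (simp add: continuous_embedding_def)
  interpret j: bounded_linear j by fact
  have DA: "subspace DA" using A by (simp add: linear_operator_on_def)
  have add: "A (u + v) = A u + A v" "R (u + v) = R u + R v" if "u \<in> DA" "v \<in> DA" for u v
    using A R that by (simp_all add: linear_operator_on_def)
  have scale: "A (c *\<^sub>R u) = c *\<^sub>R A u" "R (c *\<^sub>R u) = c *\<^sub>R R u" if "u \<in> DA" for c u
    using A R that by (simp_all add: linear_operator_on_def)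
  have diff: "A (u - v) = A u - A v" "R (u - v) = R u - R v" if "u \<in> DA" "v \<in> DA" for u v
    using add[of "u - v" v] that subspace_diff[OF DA] by simp_all
  obtain T where "generated_group T (?D0 \<times> range j) (\<lambda>(u, v). (inv j v, A u))"
    using gen generates_group_iff unfolding generates_cosine_with_phase_space_def by blast
  then interpret generated_group T "?D0 \<times> range j" "\<lambda>(u, v). (inv j v, A u)" .
  from generator_has_resolvent
  obtain l where "\<forall>y. \<exists>!z. z \<in> ?D0 \<times> range j \<and> l *\<^sub>R z - (case z of (u, v) \<Rightarrow> (inv j v, A u)) = y" ..
  note l = spec[OF this]
  have resolvent: "\<exists>!u. u \<in> ?D0 \<and> (l * l) *\<^sub>R j u - A u = f" for f
  proof -
    obtain z where z: "z \<in> ?D0 \<times> range j" "l *\<^sub>R z - (case z of (u, v) \<Rightarrow> (inv j v, A u)) = (0, f)"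
      using ex1_implies_ex[OF l[of "(0, f)"]] by blast
    obtain u v where uv: "z = (u, v)" by (cases z)
    have u: "u \<in> ?D0" and "v \<in> range j" and *: "l *\<^sub>R u = inv j v" "l *\<^sub>R v - A u = f"
      using z by (simp_all add: uv)
    then have v: "v = l *\<^sub>R j u" by (metis f_inv_into_f j.scaleR)
    have "u' = u" if u': "u' \<in> ?D0" "(l * l) *\<^sub>R j u' - A u' = f" for u'
    proof -
      have "(u', l *\<^sub>R j u') \<in> ?D0 \<times> range j \<and>
          l *\<^sub>R (u', l *\<^sub>R j u') - (case (u', l *\<^sub>R j u') of (u, v) \<Rightarrow> (inv j v, A u)) = (0, f)"
        using u' by (simp add: inj flip: j.scaleR)
      with z l[of "(0, f)"] have "(u', l *\<^sub>R j u') = z" by blast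
      then show ?thesis by (simp add: uv)
    qed
    moreover have "(l * l) *\<^sub>R j u - A u = f" using * v by simp
    ultimately show ?thesis using u by blast
  qed
  have dirichlet: "\<exists>!e. e \<in> DA \<and> R e = x \<and> A e = (l * l) *\<^sub>R j e" for x
  proof (rule ex_ex1I)
    obtain w where w: "w \<in> DA" "R w = x" using surj by (metis UNIV_I imageE)
    obtain w0 where w0: "w0 \<in> ?D0" "(l * l) *\<^sub>R j w0 - A w0 = (l * l) *\<^sub>R j w - A w"
      using resolvent by blast
    then show "\<exists>e. e \<in> DA \<and> R e = x \<and> A e = (l * l) *\<^sub>R j e"
      using w by (intro exI[of _ "w - w0"])
        (auto simp: diff subspace_diff[OF DA] j.diff scaleR_diff_right algebra_simps)
  next
    fix e e' assume "e \<in> DA \<and> R e = x \<and> A e = (l * l) *\<^sub>R j e" "e' \<in> DA \<and> R e' = x \<and> A e' = (l * l) *\<^sub>R j e'"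
    then have "e - e' \<in> ?D0 \<and> (l * l) *\<^sub>R j (e - e') - A (e - e') = 0"
      by (simp add: diff subspace_diff[OF DA] j.diff scaleR_diff_right)
    moreover have "0 \<in> ?D0 \<and> (l * l) *\<^sub>R j 0 - A 0 = 0"
      using scale[OF subspace_0[OF DA], of 0] subspace_0[OF DA] by (simp add: j.zero)
    ultimately show "e = e'" using resolvent[of 0] by (metis eq_iff_diff_eq_0)
  qed
  then obtain E where E: "\<And>x. E x \<in> DA" "\<And>x. R (E x) = x" "\<And>x. A (E x) = (l * l) *\<^sub>R j (E x)"
    by metis
  have E_unique: "e = E x" if "e \<in> DA" "R e = x" "A e = (l * l) *\<^sub>R j e" for e x
    using dirichlet[of x] E that by blast
  have "linear E"
  proof (rule linearI)
    show "E (x + y) = E x + E y" for x y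
      by (rule E_unique[symmetric])
        (simp_all add: E add subspace_add[OF DA] j.add scaleR_add_right)
    show "E (c *\<^sub>R x) = c *\<^sub>R E x" for c x
      by (rule E_unique[symmetric])
        (simp_all add: E scale subspace_scale[OF DA] j.scaleR)
  qed
  then have "bounded_linear E"
  proof (rule closed_graph_bounded_linear)
    fix x a b assume x: "x \<longlonglongrightarrow> a" and Ex: "(\<lambda>n. E (x n)) \<longlonglongrightarrow> b"
    have "(\<lambda>n. (E (x n), A (E (x n)), R (E (x n)))) \<longlonglongrightarrow> (b, (l * l) *\<^sub>R j b, a)"
      unfolding E by (intro tendsto_intros x Ex j.tendsto)
    moreover have "(E (x n), A (E (x n)), R (E (x n))) \<in> (\<lambda>u. (u, A u, R u)) ` DA" for n
      using E(1) by blast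
    ultimately have "(b, (l * l) *\<^sub>R j b, a) \<in> (\<lambda>u. (u, A u, R u)) ` DA"
      using closed unfolding closed_operator_def by (rule_tac closed_sequentially)
    then show "E a = b" using E_unique[of b a] by auto
  qed
  then show ?thesis using E by blast
qed

text \<open>
  \<open>\<Phi>\<close> and \<open>\<Psi>\<close> are the change of variables \<open>u = w + E x\<close>, which also regroups \<open>((w, v), (d, x))\<close>, the
  phase space followed by the bounded part, as \<open>((u, v, d), x)\<close>.  \<open>G\<close> is the generator of the phase space
  group extended by \<open>0\<close>, and \<open>P\<close> collects the remaining terms of the transformed equations.
\<close>

theorem proposition2p4:
  fixes j :: "'y::banach \<Rightarrow> 'x::banach"
    and DA :: "'y set" and A :: "'y \<Rightarrow> 'x"
    and R L B1 B2 :: "'y \<Rightarrow> 'b::banach"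
    and B3 B4 :: "'b \<Rightarrow> 'b"
  assumes "continuous_embedding j"
    and "linear_operator_on DA A"
    and "linear_operator_on DA R" and "R ` DA = UNIV"
    and "bounded_linear B1" and "bounded_linear B2"
    and "bounded_linear B3" and "bounded_linear B4"
    and "closed_operator DA (\<lambda>u. (A u, R u))"
    and "generates_cosine_with_phase_space j {u \<in> DA. R u = 0} A"
    and "\<And>u. u \<in> DA \<Longrightarrow> L u = R u + B2 u"
  shows "well_posed (bigA_dom j DA) (bigA j A L) (bigR R) (bigB B1 B2 B3 B4) B4"
proof (rule well_posed_if_generates_group)
  let ?D0 = "{u \<in> DA. R u = 0}"
  obtain l E where E_lin: "bounded_linear E"
    and E: "\<And>x. E x \<in> DA" "\<And>x. R (E x) = x" "\<And>x. A (E x) = (l * l) *\<^sub>R j (E x)"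
    using dirichlet_operator_exists[OF assms(1-4,9,10)] by blast
  have j_lin: "bounded_linear j" using assms(1) by (simp add: continuous_embedding_def)
  have DA: "subspace DA" using assms(2) by (simp add: linear_operator_on_def)
  have add: "A (u + v) = A u + A v" "R (u + v) = R u + R v" if "u \<in> DA" "v \<in> DA" for u v
    using assms(2,3) that by (simp_all add: linear_operator_on_def)
  define bdry where "bdry u d x = (B1 u + B4 (B2 u)) + B3 d + B4 x" for u d x
  define G where "G = (\<lambda>(z, p :: 'b \<times> 'b). (case z of (u, v) \<Rightarrow> (inv j v, A u), 0 :: 'b \<times> 'b))"
  define P where "P = (\<lambda>((w, v :: 'x), (d, x)).
      ((- E (bdry (w + E x) d x), (l * l) *\<^sub>R j (E x)), (x + B2 (w + E x), bdry (w + E x) d x)))"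
  define \<Phi> where "\<Phi> = (\<lambda>((w, v :: 'x), (d :: 'b, x)). ((w + E x, v, d), x))"
  define \<Psi> where "\<Psi> = (\<lambda>((u, v :: 'x, d :: 'b), x). ((u - E x, v), (d, x)))"
  note lin = bounded_linear_compose[OF E_lin] bounded_linear_compose[OF j_lin]
    bounded_linear_compose[OF assms(5)] bounded_linear_compose[OF assms(6)]
    bounded_linear_compose[OF assms(7)] bounded_linear_compose[OF assms(8)]
    bounded_linear_compose[OF bounded_linear_scaleR_right] bounded_linear_Pair
    bounded_linear_add bounded_linear_sub bounded_linear_minus
    bounded_linear_fst_comp bounded_linear_snd_comp bounded_linear_ident
  have P: "bounded_linear P"
    unfolding P_def bdry_def case_prod_beta fst_conv snd_conv by (intro lin)
  have \<Phi>: "bounded_linear \<Phi>" and \<Psi>: "bounded_linear \<Psi>"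
    unfolding \<Phi>_def \<Psi>_def case_prod_beta by (intro lin)+
  have inv: "\<Psi> (\<Phi> z) = z" "\<Phi> (\<Psi> y) = y" for z y
    by (auto simp: \<Phi>_def \<Psi>_def split: prod.splits)
  have "generates_group ((?D0 \<times> range j) \<times> UNIV) G"
    using generates_group_times_trivial[of "?D0 \<times> range j" "\<lambda>(u, v). (inv j v, A u)"] assms(10)
    unfolding generates_cosine_with_phase_space_def G_def by blast
  from generates_group_similar[OF bounded_perturbation_generates_group[OF this P] \<Phi> \<Psi> inv]
  have gen: "generates_group {y. \<Psi> y \<in> (?D0 \<times> range j) \<times> UNIV} (\<lambda>y. \<Phi> (G (\<Psi> y) + P (\<Psi> y)))" .
  have shift_dom: "u - E x \<in> DA \<longleftrightarrow> u \<in> DA" for u x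
    using subspace_add[OF DA _ E(1)[of x], of "u - E x"] subspace_diff[OF DA _ E(1)[of x], of u] by auto
  have shift_R: "R (u - E x) = R u - x" if "u \<in> DA" for u x
    using add(2)[OF iffD2[OF shift_dom[of u x] that] E(1)[of x]] by (simp add: E(2))
  show "generates_group {(u, bigR R u) |u. u \<in> bigA_dom j DA}
      (\<lambda>(u, x). (bigA j A L u, bigB B1 B2 B3 B4 u + B4 x))"
  proof (rule iffD1[OF generates_group_cong gen])
    show "{y. \<Psi> y \<in> (?D0 \<times> range j) \<times> UNIV} = {(u, bigR R u) |u. u \<in> bigA_dom j DA}"
      by (auto simp: \<Psi>_def shift_dom shift_R bigR_def bigA_dom_def)
    show "\<Phi> (G (\<Psi> y) + P (\<Psi> y)) = (case y of (u, x) \<Rightarrow> (bigA j A L u, bigB B1 B2 B3 B4 u + B4 x))"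
      if y_dom: "y \<in> {(u, bigR R u) |u. u \<in> bigA_dom j DA}" for y
    proof -
      obtain u v d where y: "y = ((u, v, d), R u)" "u \<in> DA"
        using y_dom by (auto simp: bigR_def bigA_dom_def)
      from add(1)[OF iffD2[OF shift_dom[of u "R u"] this(2)] E(1)[of "R u"]] have "A (u - E (R u)) + (l * l) *\<^sub>R j (E (R u)) = A u" by (simp add: E)
      then show ?thesis
        by (simp add: y \<Phi>_def \<Psi>_def G_def P_def bigA_def bdry_def bigB_def assms(11))
    qed
  qed
qed

end
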